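(* Let $d\ge1$, $m\ge2d+1$, and let $S,T$ be triangulations of the cyclic polytope $C(m,2d)$. Then $S$ and $T$ are related by a bistellar flip if and only if $e(S)$ and $e(T)$ have all but one $(d+1)$-tuple in common, i.e. $|e(S)\setminus e(T)|=|e(T)\setminus e(S)|=1$.
   Context: $C(m,2d)\subset\mathbb R^{2d}$ is the convex hull of $p_1,\dots,p_m$ with $p_t=(t,t^2,\dots,t^{2d})$. A triangulation of $C(m,2d)$ is a subdivision of it into $2d$-dimensional simplices (any two meeting in a common, possibly empty, face) whose vertices are vertices of $C(m,2d)$. A $d$-simplex in $C(m,2d)$ is the convex hull of $d+1$ vertices, recorded as the increasing $(d+1)$-tuple of their indices from $\{1,\dots,m\}$. Lower facets of $C(m,2d)$ are the facets dividing $C(m,2d)$ from the points below it with respect to the $2d$-th coordinate. For a triangulation $S$, $e(S)$ is the set of $d$-simplices in $C(m,2d)$ which appear as a face of some simplex in $S$ and which do not lie on any lower boundary facet of $C(m,2d)$. Bistellar flip: given $2d+2$ points in $\mathbb R^{2d}$, no $2d+1$ lying in a hyperplane, there are exactly two triangulations of their convex hull with vertices among these points. A bistellar flip of a triangulation $T$ is given by specifying $2d+2$ vertices of $T$, no $2d+1$ lying in a hyperplane, such that $T$ restricts to a triangulation (using only those vertices) of the convex hull $X$ of those $2d+2$ vertices; the flip is obtained by replacing the part of $T$ inside $X$ by the other triangulation of $X$ using those vertices. *)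

theory Defs
  imports "HOL-Analysis.Analysis"
begin

text \<open>
  The coordinates of \<^typ>\<open>real ^ 'n\<close> are ordered by the linear order on the finite index
  type, so the coordinate \<open>i\<close> is the \<open>k\<close>-th one for \<open>k = card {j. j \<le> i}\<close>, and
  the last one is \<open>Max UNIV\<close>.
\<close>

definition moment_pt :: "nat \<Rightarrow> real ^ 'n::{finite,linorder}" where
  "moment_pt t = (\<chi> i. real t ^ card {j. j \<le> i})"

definition cyclic_polytope :: "nat \<Rightarrow> (real ^ 'n::{finite,linorder}) set" where
  "cyclic_polytope m = convex hull (moment_pt ` {1..m})"

definition triangulates :: "'a::euclidean_space set set \<Rightarrow> 'a set \<Rightarrow> 'a set \<Rightarrow> bool" where
  "triangulates S X V \<longleftrightarrow>
     triangulation S \<and> \<Union>S = X \<and>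
     (\<forall>\<sigma>\<in>S. int DIM('a) simplex \<sigma> \<and> {v. v extreme_point_of \<sigma>} \<subseteq> V)"

definition cyclic_triangulation :: "nat \<Rightarrow> (real ^ 'n::{finite,linorder}) set set \<Rightarrow> bool" where
  "cyclic_triangulation m S \<longleftrightarrow>
     triangulates S (cyclic_polytope m) {v. v extreme_point_of cyclic_polytope m}"

text \<open>
  A facet is lower if moving straight down from any of its points leaves the polytope.
  For a full-dimensional polytope this says that the inner normal of the facet has
  positive last coordinate; in particular vertical facets are not lower.
\<close>

definition lower_facet_of ::
    "(real ^ 'n::{finite,linorder}) set \<Rightarrow> (real ^ 'n::{finite,linorder}) set \<Rightarrow> bool" where
  "lower_facet_of F P \<longleftrightarrow>
     F facet_of P \<and> (\<forall>x\<in>F. \<forall>s>0. x - s *\<^sub>R axis (Max UNIV) 1 \<notin> P)"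

definition e_set ::
    "nat \<Rightarrow> nat \<Rightarrow> (real ^ 'n::{finite,linorder}) set set \<Rightarrow> nat list set" where
  "e_set d m S =
     {A. length A = d + 1 \<and> sorted_wrt (<) A \<and> set A \<subseteq> {1..m} \<and>
         (\<exists>\<sigma>\<in>S. convex hull (moment_pt ` set A) face_of \<sigma>) \<and>
         \<not> (\<exists>F. lower_facet_of F (cyclic_polytope m :: (real ^ 'n::{finite,linorder}) set) \<and>
                convex hull (moment_pt ` set A) \<subseteq> F)}"

definition bistellar_flip ::
    "'a::euclidean_space set set \<Rightarrow> 'a set set \<Rightarrow> bool" where
  "bistellar_flip S T \<longleftrightarrow>
     (\<exists>V. V \<subseteq> {v. \<exists>\<sigma>\<in>S. v extreme_point_of \<sigma>} \<and> card V = DIM('a) + 2 \<and>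
          (\<forall>W\<subseteq>V. card W = DIM('a) + 1 \<longrightarrow> \<not> (\<exists>a b. a \<noteq> 0 \<and> W \<subseteq> {x. a \<bullet> x = b})) \<and>
          triangulates {\<sigma>\<in>S. \<sigma> \<subseteq> convex hull V} (convex hull V) V \<and>
          (\<exists>U. triangulates U (convex hull V) V \<and> U \<noteq> {\<sigma>\<in>S. \<sigma> \<subseteq> convex hull V} \<and>
               T = (S - {\<sigma>\<in>S. \<sigma> \<subseteq> convex hull V}) \<union> U))"

text \<open>
  The points on the moment curve are indeed the vertices, so that the indices
  \<open>1, \<dots>, m\<close> label the vertices bijectively.
\<close>

lemma inj_moment_pt: "inj (moment_pt :: nat \<Rightarrow> real ^ 'n::{finite,linorder})"
proof
  fix s t :: nat
  assume "moment_pt s = (moment_pt t :: (real, 'n) vec)"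
  then have "(moment_pt s :: (real, 'n) vec) $ Min UNIV = (moment_pt t :: (real, 'n) vec) $ Min UNIV" by simp
  moreover have "{j. j \<le> Min (UNIV :: 'n set)} = {Min UNIV}"
    by (auto intro: antisym)
  ultimately show "s = t" by (simp add: moment_pt_def)
qed

lemma vertices_cyclic_polytope:
  assumes "CARD('n::{finite,linorder}) \<ge> 2"
  shows "{v. v extreme_point_of (cyclic_polytope m :: ((real, 'n) vec) set)} = moment_pt ` {1..m}"
proof -
  let ?p = "moment_pt :: nat \<Rightarrow> (real, 'n) vec"
  define i1 where "i1 = Min (UNIV :: 'n set)"
  define i2 where "i2 = Min (UNIV - {i1})"
  have ne: "UNIV - {i1} \<noteq> {}"
  proof
    assume "UNIV - {i1} = {}"
    then have "(UNIV :: 'n set) = {i1}" by blast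
    then have "CARD('n) = 1" by (metis card_1_singleton_iff One_nat_def)
    with assms show False by simp
  qed
  have i2: "i2 \<noteq> i1" using Min_in[OF _ ne] by (auto simp: i2_def)
  have i1_le: "i1 \<le> j" for j by (simp add: i1_def)
  have i2_le: "j \<noteq> i1 \<Longrightarrow> i2 \<le> j" for j by (simp add: i2_def)
  have "{j. j \<le> i1} = {i1}" using i1_le by (auto intro: antisym)
  then have c1: "?p t $ i1 = real t" for t by (simp add: moment_pt_def)
  have "{j. j \<le> i2} = {i1, i2}" using i1_le i2_le by (auto intro: antisym)
  then have c2: "?p t $ i2 = (real t)\<^sup>2" for t
    using i2 by (simp add: moment_pt_def power2_eq_square)
  have ext: "?p t extreme_point_of cyclic_polytope m" if t: "t \<in> {1..m}" for t
  proof -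
    define a :: "(real, 'n) vec" where "a = axis i2 1 - (2 * real t) *\<^sub>R axis i1 1"
    have a: "a \<bullet> ?p s = (real s - real t)\<^sup>2 - (real t)\<^sup>2" for s
      by (simp add: a_def inner_diff_left inner_axis' c1 c2 power2_eq_square algebra_simps)
    have "?p t \<notin> convex hull (?p ` ({1..m} - {t}))"
    proof
      assume in_hull: "?p t \<in> convex hull (?p ` ({1..m} - {t}))"
      have "?p ` ({1..m} - {t}) \<subseteq> {x. a \<bullet> x > - (real t)\<^sup>2}"
        by (auto simp: a)
      then have "convex hull (?p ` ({1..m} - {t})) \<subseteq> {x. a \<bullet> x > - (real t)\<^sup>2}"
        by (intro hull_minimal convex_halfspace_gt)
      with in_hull show False by (auto simp: a)
    qed
    moreover have "?p ` {1..m} = insert (?p t) (?p ` ({1..m} - {t}))"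
      using t by blast
    ultimately show ?thesis
      unfolding cyclic_polytope_def
      using extreme_point_of_convex_hull_insert[of "?p ` ({1..m} - {t})" "?p t"] by simp
  qed
  then show ?thesis
    unfolding cyclic_polytope_def using extreme_point_of_convex_hull by blast
qed

end

theory Submission
  imports Defs
begin

text \<open>
  The argument rests on the fact that the vertex set \<open>P\<close> of the cyclic polytope in \<open>\<real>\<^bsup>2d\<^esup>\<close> is
  neighbourly: every nonzero affine relation among the points of \<open>P\<close> has at
  least \<open>d + 1\<close> positive and at least \<open>d + 1\<close> negative coefficients. On the moment curve this
  holds because an affine relation annihilates all polynomials of degree at most \<open>2d\<close>, in
  particular the square of a polynomial that vanishes exactly at the points with positive
  coefficient; with at most \<open>d\<close> such points the relation would have no negative part
  (\<open>moment_curve_neighbourly\<close>). By elimination every affine relation contains, sign by sign, a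
  circuit, that is, a relation with exactly \<open>d + 1\<close> coefficients of each sign
  (\<open>contains_circuit\<close>); its positive and negative parts are two \<open>d\<close>-simplices whose relative
  interiors meet in one point.

  Triangulations are handled through one statement: each point of the polytope has exactly one
  system of barycentric coordinates whose support lies in a cell (\<open>cell_weights_exist\<close>,
  \<open>cell_weights_unique\<close>). Comparing the coordinates of a point in a nonface with those in its cell
  yields an affine relation and hence a circuit, so a set of vertices is a face unless it contains
  a \<open>d\<close>-simplex crossed by a \<open>d\<close>-face of the triangulation (\<open>nonface_crossed\<close>), while two
  \<open>d\<close>-faces never cross. Consequently the \<open>d\<close>-faces determine the triangulation, and a \<open>d\<close>-simplex
  that is a face of one triangulation but not of another one is crossed; such a simplex lies in no
  facet of the polytope, so that leaving out the simplices in lower facets does not affect the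
  differences of the sets \<open>e\<close>.

  If \<open>T\<close> is a flip of \<open>S\<close> on \<open>2d + 2\<close> points, these points carry a circuit \<open>c\<close>, and the two
  triangulations of their hull consist of the simplices omitting one point of the positive part
  or one point of the negative part. The first one has all \<open>d\<close>-simplices but the positive part
  as faces and the second one all but the negative part, so exactly these two get exchanged
  (\<open>flip_imp_exchange\<close>).

  Conversely let the \<open>d\<close>-face \<open>A\<close> of \<open>S\<close> be exchanged for \<open>B\<close>. Then \<open>A\<close> and \<open>B\<close> are the two parts of a
  circuit, and \<open>A\<close> is the only \<open>d\<close>-face of \<open>S\<close> that crosses \<open>B\<close>. For a point \<open>z\<close> inside \<open>B\<close>, the
  difference between its coordinates in \<open>B\<close> and in its cell of \<open>S\<close> is an affine relation with
  positive part in \<open>B\<close>, and all circuits in it have the parts \<open>B\<close> and \<open>A\<close>; hence it is a multiple of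
  the given circuit (\<open>relation_on_single_crossing\<close>). A suitable choice of \<open>z\<close> then shows that
  \<open>A \<union> B - {b}\<close> is a cell of \<open>S\<close> for every \<open>b\<close> in \<open>B\<close> (\<open>single_crossing_filled\<close>), so \<open>S\<close>, and by
  symmetry \<open>T\<close>, restricts to a triangulation of the hull of \<open>A \<union> B\<close>. All other cells have only
  common \<open>d\<close>-faces of \<open>S\<close> and \<open>T\<close> and therefore belong to both (\<open>exchange_imp_flip\<close>).
\<close>

section \<open>Affine relations and neighbourly point sets\<close>

abbreviation pos :: "('a \<Rightarrow> real) \<Rightarrow> 'a set" where "pos u \<equiv> {v. 0 < u v}"
abbreviation neg :: "('a \<Rightarrow> real) \<Rightarrow> 'a set" where "neg u \<equiv> {v. u v < 0}"

text \<open>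
  Coefficient functions are defined on the whole space and vanish outside \<open>P\<close>. In this way
  coordinates with respect to different simplices can be subtracted, and a simplex only
  restricts the support.
\<close>
definition affine_relation :: "'a::euclidean_space set \<Rightarrow> ('a \<Rightarrow> real) \<Rightarrow> bool" where
  "affine_relation P u \<longleftrightarrow>
     (\<forall>v. v \<notin> P \<longrightarrow> u v = 0) \<and> (\<Sum>v\<in>P. u v) = 0 \<and> (\<Sum>v\<in>P. u v *\<^sub>R v) = 0"

definition barycentric :: "'a::euclidean_space set \<Rightarrow> ('a \<Rightarrow> real) \<Rightarrow> 'a \<Rightarrow> bool" where
  "barycentric P w z \<longleftrightarrow> (\<forall>v. 0 \<le> w v) \<and> (\<forall>v. v \<notin> P \<longrightarrow> w v = 0) \<and>
     (\<Sum>v\<in>P. w v) = 1 \<and> (\<Sum>v\<in>P. w v *\<^sub>R v) = z"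

text \<open>
  In the neighbourly sets below, the positive and the negative points of a circuit span two
  \<open>d\<close>-simplices that cross in a point of both relative interiors, and all pairs of crossing
  \<open>d\<close>-simplices arise in this way.
\<close>
definition circuit :: "'a::euclidean_space set \<Rightarrow> nat \<Rightarrow> ('a \<Rightarrow> real) \<Rightarrow> bool" where
  "circuit P d u \<longleftrightarrow> affine_relation P u \<and> card (pos u) = d + 1 \<and> card (neg u) = d + 1"

definition cells :: "'a::euclidean_space set \<Rightarrow> 'a set set \<Rightarrow> 'a set set" where
  "cells P S = {C. C \<subseteq> P \<and> card C = DIM('a) + 1 \<and> convex hull C \<in> S}"

text \<open>
  Faces are recorded by their vertex sets; \<open>d\<close> will be half the dimension of the space.
\<close>
definition mid_faces :: "'a::euclidean_space set \<Rightarrow> nat \<Rightarrow> 'a set set \<Rightarrow> 'a set set" where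
  "mid_faces P d S = {A. card A = d + 1 \<and> (\<exists>C\<in>cells P S. A \<subseteq> C)}"

lemma affine_relation_uminus: "affine_relation P u \<Longrightarrow> affine_relation P (\<lambda>v. - u v)"
  by (simp add: affine_relation_def sum_negf)

lemma finite_minimizer:
  fixes f :: "'a \<Rightarrow> real"
  assumes "finite X" "X \<noteq> {}"
  obtains b where "b \<in> X" "\<And>y. y \<in> X \<Longrightarrow> f b \<le> f y"
proof -
  have "Min (f ` X) \<in> f ` X" using assms by (intro Min_in) auto
  then obtain b where "b \<in> X" "Min (f ` X) = f b" by blast
  moreover have "Min (f ` X) \<le> f y" if "y \<in> X" for y using assms(1) that by (intro Min_le) auto
  ultimately show ?thesis using that by metis
qed

lemma sum_scaled:
  fixes f :: "'a \<Rightarrow> 'b::real_vector"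
  shows "(\<Sum>x\<in>P. (t * v x) *\<^sub>R f x) = t *\<^sub>R (\<Sum>x\<in>P. v x *\<^sub>R f x)"
  by (simp add: scaleR_right.sum)

lemma affine_relation_diff:
  "affine_relation P u \<Longrightarrow> affine_relation P v \<Longrightarrow> affine_relation P (\<lambda>x. u x - t * v x)"
  using sum_scaled[where f="\<lambda>_. 1::real" and t=t and v=v and P=P] sum_scaled[where f="\<lambda>x. x" and t=t and v=v and P=P]
  by (simp add: affine_relation_def sum_subtractf scaleR_diff_left)

lemma affine_relation_mono:
  assumes "finite P" "V \<subseteq> P" "affine_relation V u"
  shows "affine_relation P u"
proof -
  have "(\<Sum>v\<in>P. u v) = (\<Sum>v\<in>V. u v)" "(\<Sum>v\<in>P. u v *\<^sub>R v) = (\<Sum>v\<in>V. u v *\<^sub>R v)"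
    using assms(3) by (intro sum.mono_neutral_right[OF assms(1,2)]; force simp: affine_relation_def)+
  with assms show ?thesis by (auto simp: affine_relation_def)
qed

lemma circuit_uminus: "circuit P d u \<Longrightarrow> circuit P d (\<lambda>v. - u v)"
  by (simp add: circuit_def affine_relation_uminus)

lemma barycentric_diff:
  "barycentric P w z \<Longrightarrow> barycentric P w' z \<Longrightarrow> affine_relation P (\<lambda>v. w v - w' v)"
  by (simp add: barycentric_def affine_relation_def sum_subtractf scaleR_diff_left)

text \<open>
  The coordinates of a fixed point form the intersection of an affine space, whose directions
  are the affine relations, with the nonnegative orthant.
\<close>
lemma barycentric_shift:
  assumes "barycentric P w z" "affine_relation P u" "\<And>v. 0 \<le> w v - t * u v"
  shows "barycentric P (\<lambda>v. w v - t * u v) z"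
  using assms sum_scaled[where f="\<lambda>_. 1::real" and t=t and v=u and P=P] sum_scaled[where f="\<lambda>x. x" and t=t and v=u and P=P]
  by (simp add: affine_relation_def barycentric_def sum_subtractf scaleR_diff_left)

lemma hull_imp_barycentric:
  assumes "finite P" "C \<subseteq> P" "z \<in> convex hull C"
  shows "\<exists>w. barycentric P w z \<and> pos w \<subseteq> C"
proof -
  have fC: "finite C" using assms finite_subset by blast
  from assms obtain u where u: "\<forall>x\<in>C. 0 \<le> u x" "sum u C = 1" "(\<Sum>x\<in>C. u x *\<^sub>R x) = z"
    unfolding convex_hull_finite[OF fC] by blast
  define w where "w = (\<lambda>v. if v \<in> C then u v else 0)"
  have "(\<Sum>v\<in>P. w v) = (\<Sum>v\<in>C. u v)" "(\<Sum>v\<in>P. w v *\<^sub>R v) = (\<Sum>v\<in>C. u v *\<^sub>R v)"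
    using assms by (auto intro!: sum.mono_neutral_cong_right simp: w_def)
  then have "barycentric P w z" using u assms(2) by (auto simp: barycentric_def w_def)
  moreover have "pos w \<subseteq> C" by (auto simp: w_def)
  ultimately show ?thesis by blast
qed

lemma barycentric_imp_hull:
  assumes "finite P" "barycentric P w z" "pos w \<subseteq> C"
  shows "z \<in> convex hull C"
proof -
  have sub: "pos w \<subseteq> P" using assms(2) by (force simp: barycentric_def)
  then have f: "finite (pos w)" using assms(1) finite_subset by blast
  have z: "\<forall>v\<in>P - pos w. w v = 0"
  proof
    fix v assume "v \<in> P - pos w"
    moreover have "0 \<le> w v" using assms(2) by (simp add: barycentric_def)
    ultimately show "w v = 0" by simp
  qed
  then have z': "\<forall>v\<in>P - pos w. w v *\<^sub>R v = 0" by (metis scaleR_zero_left)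
  have "(\<Sum>v\<in>P. w v) = (\<Sum>v\<in>pos w. w v)" "(\<Sum>v\<in>P. w v *\<^sub>R v) = (\<Sum>v\<in>pos w. w v *\<^sub>R v)"
    by (rule sum.mono_neutral_right[OF assms(1) sub z] sum.mono_neutral_right[OF assms(1) sub z'])+
  then have "z \<in> convex hull (pos w)"
    using assms(2) unfolding convex_hull_finite[OF f] barycentric_def
    by (intro CollectI exI[of _ w]) simp
  then show ?thesis using hull_mono[OF assms(3)] by blast
qed

lemma barycentric_exists_pos:
  assumes "finite P" "C \<subseteq> P" "C \<noteq> {}"
  shows "\<exists>w z. barycentric P w z \<and> pos w = C"
proof -
  have fC: "finite C" using assms finite_subset by blast
  define w where "w = (\<lambda>v. if v \<in> C then 1 / real (card C) else 0)"
  have "(\<Sum>v\<in>P. w v) = (\<Sum>v\<in>C. 1 / real (card C))"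
    unfolding w_def using assms by (intro sum.mono_neutral_cong_right) auto
  also have "\<dots> = 1" using fC assms by simp
  finally have "(\<Sum>v\<in>P. w v) = 1" .
  moreover have "0 \<le> w v" "v \<notin> P \<Longrightarrow> w v = 0" for v using assms(2) by (auto simp: w_def)
  ultimately have "barycentric P w (\<Sum>v\<in>P. w v *\<^sub>R v)" by (simp add: barycentric_def)
  moreover have "pos w = C" using fC assms by (auto simp: w_def card_gt_0_iff split: if_splits)
  ultimately show ?thesis by blast
qed

lemma barycentric_combine:
  assumes "barycentric P w y" "barycentric P w' z" "0 \<le> t" "t \<le> 1"
  shows "barycentric P (\<lambda>v. (1 - t) * w v + t * w' v) ((1 - t) *\<^sub>R y + t *\<^sub>R z)"
proof -
  have "(\<Sum>v\<in>P. ((1 - t) * w v + t * w' v)) = (1 - t) * (\<Sum>v\<in>P. w v) + t * (\<Sum>v\<in>P. w' v)"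
    by (simp add: sum.distrib sum_distrib_left)
  moreover have "(\<Sum>v\<in>P. ((1 - t) * w v + t * w' v) *\<^sub>R v)
      = (1 - t) *\<^sub>R (\<Sum>v\<in>P. w v *\<^sub>R v) + t *\<^sub>R (\<Sum>v\<in>P. w' v *\<^sub>R v)"
    by (simp add: sum.distrib scaleR_add_left scaleR_right.sum)
  ultimately show ?thesis using assms by (auto simp: barycentric_def)
qed

lemma sum_split_pos_neg:
  fixes g :: "'a \<Rightarrow> 'b::real_vector"
  shows "(\<Sum>v\<in>P. u v *\<^sub>R g v) = (\<Sum>v\<in>P. max 0 (u v) *\<^sub>R g v) - (\<Sum>v\<in>P. max 0 (- u v) *\<^sub>R g v)"
  unfolding sum_subtractf[symmetric] by (intro sum.cong refl) (auto simp: max_def scaleR_left_diff_distrib[symmetric])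

text \<open>
  Separating the positive from the negative terms of an affine relation represents one and the
  same point twice; both parts have the same total weight \<open>s\<close> since the coefficients add up
  to 0.
\<close>
lemma relation_crossing_point:
  assumes "finite P" "affine_relation P u" "u \<noteq> (\<lambda>_. 0)"
  shows "\<exists>s z. 0 < s \<and> barycentric P (\<lambda>v. max 0 (u v) / s) z \<and> barycentric P (\<lambda>v. max 0 (- u v) / s) z"
proof -
  define s where "s = (\<Sum>v\<in>P. max 0 (u v))"
  define y where "y = (\<Sum>v\<in>P. max 0 (u v) *\<^sub>R v)"
  have s2: "(\<Sum>v\<in>P. max 0 (- u v)) = s"
    using sum_split_pos_neg[where u=u and g="\<lambda>_. 1::real" and P=P] assms(2) by (simp add: s_def affine_relation_def)
  have y2: "(\<Sum>v\<in>P. max 0 (- u v) *\<^sub>R v) = y"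
    using sum_split_pos_neg[where u=u and g="\<lambda>v. v" and P=P] assms(2) by (simp add: y_def affine_relation_def)
  have "0 < s"
  proof (rule ccontr)
    assume "\<not> 0 < s"
    moreover have "0 \<le> s" by (simp add: s_def sum_nonneg)
    ultimately have "s = 0" by simp
    then have "\<forall>v\<in>P. max 0 (u v) = 0" "\<forall>v\<in>P. max 0 (- u v) = 0"
      using assms(1) s2 by (simp_all add: s_def sum_nonneg_eq_0_iff)
    then have "\<forall>v\<in>P. u v = 0" by (metis max.absorb2 max_def neg_0_le_iff_le linorder_le_cases neg_equal_0_iff_equal)
    then have "u = (\<lambda>_. 0)" using assms(2) unfolding affine_relation_def by blast
    with assms(3) show False by simp
  qed
  moreover have "barycentric P (\<lambda>v. f v / s) (y /\<^sub>R s)"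
    if "\<And>v. 0 \<le> f v" "\<And>v. v \<notin> P \<Longrightarrow> f v = 0" "(\<Sum>v\<in>P. f v) = s" "(\<Sum>v\<in>P. f v *\<^sub>R v) = y" for f
  proof -
    have "(\<Sum>v\<in>P. f v / s) = 1" using that(3) \<open>0 < s\<close> by (simp flip: sum_divide_distrib)
    moreover have "(\<Sum>v\<in>P. (f v / s) *\<^sub>R v) = y /\<^sub>R s"
      using sum_scaled[where f="\<lambda>x. x" and t="inverse s" and v=f and P=P] that(4) by (simp add: divide_inverse mult.commute)
    ultimately show ?thesis using that(1,2) \<open>0 < s\<close> by (simp add: barycentric_def)
  qed
  note this[of "\<lambda>v. max 0 (u v)"] this[of "\<lambda>v. max 0 (- u v)"]
  ultimately have "0 < s" "barycentric P (\<lambda>v. max 0 (u v) / s) (y /\<^sub>R s)"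
    "barycentric P (\<lambda>v. max 0 (- u v) / s) (y /\<^sub>R s)"
    using s2 y2 assms(2) by (simp_all add: s_def y_def affine_relation_def)
  then show ?thesis by blast
qed

text \<open>
  The condition \<open>card_pos\<close> says that any \<open>d\<close> of the points span a face of the hull, because otherwise
  an affine relation would have its positive part among them.
\<close>
locale neighbourly =
  fixes P :: "'a::euclidean_space set" and d :: nat
  assumes finite_P: "finite P"
    and dim: "DIM('a) = 2 * d"
    and d_pos: "1 \<le> d"
    and card_pos: "affine_relation P u \<Longrightarrow> u \<noteq> (\<lambda>_. 0) \<Longrightarrow> d + 1 \<le> card (pos u)"
begin

lemma card_neg: "affine_relation P u \<Longrightarrow> u \<noteq> (\<lambda>_. 0) \<Longrightarrow> d + 1 \<le> card (neg u)"
  using card_pos[OF affine_relation_uminus, of u] by (simp add: fun_eq_iff)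

lemma neighbourly_subset:
  assumes "V \<subseteq> P" shows "neighbourly V d"
proof
  show "finite V" using assms finite_P finite_subset by blast
  show "DIM('a) = 2 * d" "1 \<le> d" by (rule dim d_pos)+
  show "d + 1 \<le> card (pos u)" if "affine_relation V u" "u \<noteq> (\<lambda>_. 0)" for u
    using card_pos[OF affine_relation_mono[OF finite_P assms that(1)] that(2)] .
qed

lemma finite_subset_P: "C \<subseteq> P \<Longrightarrow> finite C"
  using finite_P finite_subset by blast

lemma supp_subset: "affine_relation P u \<Longrightarrow> pos u \<subseteq> P" "affine_relation P u \<Longrightarrow> neg u \<subseteq> P"
  by (force simp: affine_relation_def)+

lemma finite_pos: "affine_relation P u \<Longrightarrow> finite (pos u)" "affine_relation P u \<Longrightarrow> finite (neg u)"
  using supp_subset finite_subset_P by blast+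

lemma relation_small_support:
  assumes u: "affine_relation P u" and X: "\<And>v. v \<notin> X \<Longrightarrow> u v = 0" "finite X" "card X \<le> 2 * d + 1"
  shows "u = (\<lambda>_. 0)"
proof (rule ccontr)
  assume "u \<noteq> (\<lambda>_. 0)"
  then have "2 * d + 2 \<le> card (pos u) + card (neg u)" using card_pos card_neg u by fastforce
  also have "\<dots> = card (pos u \<union> neg u)"
    using finite_pos[OF u] by (intro card_Un_disjoint[symmetric]) auto
  also have "\<dots> \<le> card X" using X(1) by (intro card_mono X(2)) force
  finally show False using X(3) by simp
qed

lemma affine_independent:
  assumes "C \<subseteq> P" "card C \<le> 2 * d + 1"
  shows "\<not> affine_dependent C"
proof
  assume "affine_dependent C"
  then obtain U where U: "sum U C = 0" "\<exists>v\<in>C. U v \<noteq> 0" "(\<Sum>v\<in>C. U v *\<^sub>R v) = 0"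
    unfolding affine_dependent_explicit_finite[OF finite_subset_P[OF assms(1)]] by blast
  define u where "u = (\<lambda>v. if v \<in> C then U v else 0)"
  have "affine_relation C u" using U by (simp add: affine_relation_def u_def)
  then have "affine_relation P u" using affine_relation_mono finite_P assms(1) by blast
  then have "u = (\<lambda>_. 0)"
    by (rule relation_small_support[of _ C]) (use assms finite_subset_P in \<open>auto simp: u_def\<close>)
  with U(2) show False by (metis u_def)
qed

lemma relation_exists:
  assumes "X \<subseteq> P" "2 * d + 2 \<le> card X"
  shows "\<exists>u. affine_relation P u \<and> u \<noteq> (\<lambda>_. 0) \<and> (\<forall>v. v \<notin> X \<longrightarrow> u v = 0)"
proof -
  have fX: "finite X" using assms finite_subset_P by blast
  have "affine_dependent X" using affine_dependent_biggerset[OF fX] assms(2) dim by simp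
  then obtain U where U: "sum U X = 0" "\<exists>v\<in>X. U v \<noteq> 0" "(\<Sum>v\<in>X. U v *\<^sub>R v) = 0"
    unfolding affine_dependent_explicit_finite[OF fX] by blast
  define u where "u = (\<lambda>v. if v \<in> X then U v else 0)"
  have "affine_relation X u" using U by (simp add: affine_relation_def u_def)
  then have "affine_relation P u" using affine_relation_mono finite_P assms(1) by blast
  moreover have "u \<noteq> (\<lambda>_. 0)" using U(2) by (metis u_def)
  moreover have "\<forall>v. v \<notin> X \<longrightarrow> u v = 0" by (simp add: u_def)
  ultimately show ?thesis by blast
qed

text \<open>
  If the support of \<open>u\<close> has more than \<open>2d + 2\<close> points, then \<open>2d + 2\<close> of them carry another relation
  \<open>v\<close>. Subtracting the multiple of \<open>v\<close> by the quotient \<open>u x / v x\<close> of smallest absolute value kills the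
  coefficient at \<open>x\<close> without reversing the sign of any other one, and the result is nonzero because
  \<open>v\<close> does not reach the whole support. A relation that cannot be shortened has at most \<open>2d + 2\<close>
  coefficients, hence exactly \<open>d + 1\<close> of each sign.
\<close>
lemma contains_circuit:
  assumes "affine_relation P u" "u \<noteq> (\<lambda>_. 0)"
  shows "\<exists>c. circuit P d c \<and> pos c \<subseteq> pos u \<and> neg c \<subseteq> neg u"
  using assms
proof (induction "card (pos u \<union> neg u)" arbitrary: u rule: less_induct)
  case less
  note u = less.prems
  have fin: "finite (pos u \<union> neg u)" using finite_pos[OF u(1)] by simp
  have cu: "card (pos u \<union> neg u) = card (pos u) + card (neg u)"
    using finite_pos[OF u(1)] by (intro card_Un_disjoint) auto
  show ?case
  proof (cases "card (pos u \<union> neg u) \<le> 2 * d + 2")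
    case True
    then have "circuit P d u" using cu card_pos[OF u] card_neg[OF u] u(1) by (simp add: circuit_def)
    then show ?thesis by blast
  next
    case False
    then obtain X where X: "X \<subseteq> pos u \<union> neg u" "card X = 2 * d + 2"
      by (metis nat_le_linear obtain_subset_with_card_n)
    have "X \<subseteq> P" using X supp_subset[OF u(1)] by blast
    with X obtain v where v: "affine_relation P v" "v \<noteq> (\<lambda>_. 0)" "\<forall>x. x \<notin> X \<longrightarrow> v x = 0"
      using relation_exists by (metis order_refl)
    define Y where "Y = {x. v x \<noteq> 0}"
    have Y: "Y \<subseteq> X" "Y \<noteq> {}" using v by (auto simp: Y_def)
    have fY: "finite Y" using Y X fin finite_subset by metis
    obtain x where x: "x \<in> Y" "\<And>y. y \<in> Y \<Longrightarrow> \<bar>u x\<bar> / \<bar>v x\<bar> \<le> \<bar>u y\<bar> / \<bar>v y\<bar>"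
      by (rule finite_minimizer[OF fY Y(2), of "\<lambda>y. \<bar>u y\<bar> / \<bar>v y\<bar>"]) blast
    define t where "t = u x / v x"
    define u' where "u' = (\<lambda>y. u y - t * v y)"
    have bound: "\<bar>t * v y\<bar> \<le> \<bar>u y\<bar>" for y
    proof (cases "y \<in> Y")
      case True
      then have "\<bar>t\<bar> \<le> \<bar>u y\<bar> / \<bar>v y\<bar>" using x(2) by (simp add: t_def abs_divide)
      then show ?thesis using True by (simp add: Y_def abs_mult field_simps)
    qed (simp add: Y_def)
    have sub: "pos u' \<subseteq> pos u" "neg u' \<subseteq> neg u"
      using bound unfolding u'_def by (auto simp: abs_if split: if_splits) (smt (verit) bound)+
    have rel: "affine_relation P u'" unfolding u'_def using affine_relation_diff u v by blast
    have "\<not> pos u \<union> neg u \<subseteq> X" 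
      using False X(2) card_mono[of X "pos u \<union> neg u"] finite_subset[OF X(1) fin] by linarith
    then obtain y where y: "u y \<noteq> 0" "y \<notin> X" by (force simp: subset_iff)
    then have "u' y \<noteq> 0" using v(3) by (simp add: u'_def)
    then have nz: "u' \<noteq> (\<lambda>_. 0)" by auto
    have "x \<in> pos u \<union> neg u" using x Y X by blast
    moreover have "u' x = 0" using x(1) by (simp add: u'_def t_def Y_def)
    ultimately have "pos u' \<union> neg u' \<subset> pos u \<union> neg u" using sub by force
    then have "card (pos u' \<union> neg u') < card (pos u \<union> neg u)" by (rule psubset_card_mono[OF fin])
    from less.hyps[OF this rel nz] show ?thesis using sub by blast
  qed
qed

lemma circuit_nonzero: "circuit P d c \<Longrightarrow> c \<noteq> (\<lambda>_. 0)"
  by (auto simp: circuit_def)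

lemma circuit_card: "circuit P d c \<Longrightarrow> card (pos c \<union> neg c) = 2 * d + 2"
proof -
  assume c: "circuit P d c"
  then have "card (pos c \<union> neg c) = card (pos c) + card (neg c)"
    using finite_pos[of c] by (intro card_Un_disjoint) (auto simp: circuit_def)
  then show ?thesis using c by (simp add: circuit_def)
qed

lemma circuit_supp: "circuit P d c \<Longrightarrow> pos c \<union> neg c \<subseteq> P"
  using supp_subset by (auto simp: circuit_def)

text \<open>
  Any multiple of \<open>c\<close> that cancels one coefficient of \<open>u\<close> leaves a relation supported on \<open>2d + 1\<close>
  affinely independent points.
\<close>
lemma relation_on_circuit_support:
  assumes c: "circuit P d c" and u: "affine_relation P u" "\<And>v. c v = 0 \<Longrightarrow> u v = 0"
  shows "\<exists>t. u = (\<lambda>v. t * c v)"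
proof -
  have "pos c \<noteq> {}" using c unfolding circuit_def by (metis add_is_0 card.empty one_neq_zero)
  then obtain x where x: "0 < c x" by auto
  define t where "t = u x / c x"
  have "(\<lambda>v. u v - t * c v) = (\<lambda>_. 0)"
  proof (rule relation_small_support[of _ "pos c \<union> neg c - {x}"])
    show "affine_relation P (\<lambda>v. u v - t * c v)"
      by (rule affine_relation_diff) (use u c in \<open>simp_all add: circuit_def\<close>)
    show "u v - t * c v = 0" if "v \<notin> pos c \<union> neg c - {x}" for v
      using that x u(2) by (cases "v = x") (auto simp: t_def not_less order_antisym)
    show "finite (pos c \<union> neg c - {x})" using c finite_pos by (auto simp: circuit_def)
    then show "card (pos c \<union> neg c - {x}) \<le> 2 * d + 1"
      using x circuit_card[OF c] by simp
  qed
  then show ?thesis by (metis eq_iff_diff_eq_0)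
qed

section \<open>Triangulations through barycentric coordinates\<close>

lemma cells_D: "C \<in> cells P S \<Longrightarrow> C \<subseteq> P \<and> card C = 2 * d + 1 \<and> convex hull C \<in> S"
  by (simp add: cells_def dim)

lemma cell_independent: "C \<in> cells P S \<Longrightarrow> \<not> affine_dependent C"
  using cells_D affine_independent by fastforce

lemma triangulates_cell:
  assumes "triangulates S X P" "\<sigma> \<in> S"
  obtains C where "C \<in> cells P S" "\<sigma> = convex hull C"
proof -
  have "int DIM('a) simplex \<sigma>" and ext: "{v. v extreme_point_of \<sigma>} \<subseteq> P"
    using assms by (auto simp: triangulates_def)
  then obtain C where C: "\<not> affine_dependent C" "int (card C) = int DIM('a) + 1" "\<sigma> = convex hull C"
    unfolding simplex_def by blast
  then have "C \<subseteq> P" using ext extreme_point_of_convex_hull_affine_independent by blast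
  then have "C \<in> cells P S" using C assms(2) by (simp add: cells_def)
  then show ?thesis using that C by blast
qed

lemma hull_inj:
  assumes "\<not> affine_dependent C" "\<not> affine_dependent C'" "convex hull C = convex hull (C' :: 'a set)"
  shows "C = C'"
proof -
  have "C = {x. x extreme_point_of convex hull C}" "C' = {x. x extreme_point_of convex hull C'}"
    using assms(1,2) extreme_point_of_convex_hull_affine_independent by blast+
  then show ?thesis using assms(3) by simp
qed

lemma cell_weights_exist:
  assumes "triangulates S (convex hull P) P" "z \<in> convex hull P"
  shows "\<exists>C\<in>cells P S. \<exists>w. barycentric P w z \<and> pos w \<subseteq> C"
proof -
  obtain \<sigma> where "\<sigma> \<in> S" "z \<in> \<sigma>" using assms unfolding triangulates_def by (metis UnionE)
  then show ?thesis
    using triangulates_cell[OF assms(1)] hull_imp_barycentric[OF finite_P] cells_D by metis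
qed

lemma independent_weights_unique:
  assumes "C \<subseteq> P" "card C \<le> 2 * d + 1" "barycentric P w z" "pos w \<subseteq> C"
    "barycentric P w' z" "pos w' \<subseteq> C"
  shows "w = w'"
proof -
  have "w v - w' v = 0" if "v \<notin> C" for v
  proof -
    have "0 \<le> w v" "0 \<le> w' v" using assms(3,5) by (auto simp: barycentric_def)
    moreover have "\<not> 0 < w v" "\<not> 0 < w' v" using assms(4,6) that by auto
    ultimately show ?thesis by simp
  qed
  then have "(\<lambda>v. w v - w' v) = (\<lambda>_. 0)"
    using relation_small_support[OF barycentric_diff[OF assms(3,5)], of C] assms(1,2) finite_subset_P
    by blast
  then show ?thesis by (metis eq_iff_diff_eq_0 ext)
qed

text \<open>
  Two cells meet in a common face, which is the hull of one and the same set of vertices of both.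
  The coordinates of a point of that face with respect to these vertices are the coordinates in
  either cell.
\<close>
lemma cell_weights_unique:
  assumes S: "triangulates S X P" and C: "C \<in> cells P S" "C' \<in> cells P S"
    and w: "barycentric P w z" "pos w \<subseteq> C" "barycentric P w' z" "pos w' \<subseteq> C'"
  shows "w = w'"
proof -
  let ?K = "convex hull C \<inter> convex hull C'"
  have "triangulation S" using S by (simp add: triangulates_def)
  then have "?K face_of convex hull C" "?K face_of convex hull C'"
    using cells_D[OF C(1)] cells_D[OF C(2)] unfolding triangulation_def by (metis Int_commute)+
  then obtain k k' where k: "k \<subseteq> C" "?K = convex hull k" "k' \<subseteq> C'" "?K = convex hull k'"
    using face_of_convex_hull_affine_independent cell_independent C by metis
  have "k = k'" using k hull_inj cell_independent C affine_dependent_subset by metis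
  have "z \<in> convex hull k" using w barycentric_imp_hull[OF finite_P] k(2) by blast
  then obtain w'' where w'': "barycentric P w'' z" "pos w'' \<subseteq> k"
    using hull_imp_barycentric[OF finite_P, of k z] k(1) cells_D[OF C(1)] by (meson order_trans)
  have "w = w''"
    using independent_weights_unique[of C w z w''] w w'' k cells_D[OF C(1)] by auto
  moreover have "w' = w''"
    using independent_weights_unique[of C' w' z w''] w w'' k \<open>k = k'\<close> cells_D[OF C(2)] by auto
  ultimately show ?thesis by simp
qed

lemma no_crossing:
  assumes S: "triangulates S X P" and C: "C \<in> cells P S" "C' \<in> cells P S"
    and u: "affine_relation P u" "u \<noteq> (\<lambda>_. 0)" "pos u \<subseteq> C" "neg u \<subseteq> C'"
  shows False
proof -
  obtain s z where s: "0 < s" "barycentric P (\<lambda>v. max 0 (u v) / s) z" "barycentric P (\<lambda>v. max 0 (- u v) / s) z"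
    using relation_crossing_point[OF finite_P u(1,2)] by blast
  have "pos (\<lambda>v. max 0 (u v) / s) \<subseteq> C" "pos (\<lambda>v. max 0 (- u v) / s) \<subseteq> C'"
    using u s(1) by (auto simp: zero_less_divide_iff max_def split: if_splits)
  from cell_weights_unique[OF S C s(2) this(1) s(3) this(2)]
  have "max 0 (u v) = max 0 (- u v)" for v using s(1) by (simp add: fun_eq_iff)
  then have "u v = 0" for v by (smt (verit))
  then show False using u(2) by blast
qed

text \<open>
  A point in the relative interior of the hull of \<open>A\<close> has other coordinates in its cell, and
  the difference of the two is positive only on \<open>A\<close> and negative only on the cell.
\<close>
lemma nonface_crossed:
  assumes S: "triangulates S (convex hull P) P" and A: "A \<subseteq> P" "A \<noteq> {}" "\<not> (\<exists>C\<in>cells P S. A \<subseteq> C)"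
  shows "\<exists>c. circuit P d c \<and> pos c \<subseteq> A \<and> neg c \<in> mid_faces P d S"
proof -
  obtain w z where w: "barycentric P w z" "pos w = A"
    using barycentric_exists_pos[OF finite_P A(1,2)] by blast
  have "z \<in> convex hull P" using barycentric_imp_hull[OF finite_P w(1)] w(2) A(1) by blast
  then obtain C w' where C: "C \<in> cells P S" "barycentric P w' z" "pos w' \<subseteq> C"
    using cell_weights_exist[OF S] by blast
  have "w \<noteq> w'" using w C A(3) by blast
  then have "(\<lambda>v. w v - w' v) \<noteq> (\<lambda>_. 0)" by (metis eq_iff_diff_eq_0 ext)
  from contains_circuit[OF barycentric_diff[OF w(1) C(2)] this]
  obtain c where c: "circuit P d c" "pos c \<subseteq> {v. 0 < w v - w' v}" "neg c \<subseteq> {v. w v - w' v < 0}"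
    by blast
  have nn: "0 \<le> w v" "0 \<le> w' v" for v using w(1) C(2) by (auto simp: barycentric_def)
  have "pos c \<subseteq> A" using c(2) w(2) nn by (force intro: order_le_less_trans)
  moreover have "neg c \<subseteq> C" using c(3) C(3) nn by (force intro: order_le_less_trans)
  ultimately show ?thesis using c(1) C(1) unfolding mid_faces_def circuit_def by blast
qed

text \<open>
  A set whose \<open>d\<close>-simplices are all faces cannot contain one that is crossed by a \<open>d\<close>-face.
\<close>
lemma triangulation_determined_by_mid_faces:
  assumes S: "triangulates S (convex hull P) P" and C: "C \<subseteq> P" "card C = 2 * d + 1"
    and faces: "\<And>A. A \<subseteq> C \<Longrightarrow> card A = d + 1 \<Longrightarrow> A \<in> mid_faces P d S"
  shows "C \<in> cells P S"
proof (rule ccontr)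
  assume not: "C \<notin> cells P S"
  have "\<not> (\<exists>C'\<in>cells P S. C \<subseteq> C')"
    using not C(2) by (metis card_subset_eq cells_D finite_subset_P)
  moreover have "C \<noteq> {}" using C(2) by auto
  ultimately obtain c where c: "circuit P d c" "pos c \<subseteq> C" "neg c \<in> mid_faces P d S"
    using nonface_crossed[OF S C(1)] by blast
  then have "pos c \<in> mid_faces P d S" using faces by (simp add: circuit_def)
  then show False using c no_crossing[OF S] circuit_nonzero
    unfolding mid_faces_def circuit_def by blast
qed

section \<open>From an exchanged face to a flip\<close>

lemma mid_faces_no_crossing:
  assumes "triangulates S X P" "circuit P d c" "pos c \<in> mid_faces P d S"
  shows "neg c \<notin> mid_faces P d S"
  using assms no_crossing[OF assms(1)] circuit_nonzero unfolding mid_faces_def circuit_def by blast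

lemma mid_face_subset: "A \<in> mid_faces P d S \<Longrightarrow> A \<subseteq> P \<and> card A = d + 1"
  using cells_D unfolding mid_faces_def by blast

lemma mid_face_nonface_crossed:
  assumes "triangulates T (convex hull P) P" "A \<in> mid_faces P d S" "A \<notin> mid_faces P d T"
  shows "\<exists>c. circuit P d c \<and> pos c = A \<and> neg c \<in> mid_faces P d T"
proof -
  have A: "A \<subseteq> P" "card A = d + 1" using mid_face_subset[OF assms(2)] by auto
  have "\<not> (\<exists>C\<in>cells P T. A \<subseteq> C)" using A assms(3) by (simp add: mid_faces_def)
  moreover have "A \<noteq> {}" using A(2) by auto
  ultimately obtain c where c: "circuit P d c" "pos c \<subseteq> A" "neg c \<in> mid_faces P d T"
    using nonface_crossed[OF assms(1) A(1)] by blast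
  then have "pos c = A" using A(2) card_subset_eq[OF finite_subset_P[OF A(1)] c(2)] by (simp add: circuit_def)
  with c show ?thesis by blast
qed

text \<open>
  Subtracting positive multiples of \<open>c\<close> from the coordinates of \<open>z\<close> decreases them on the positive part only,
  so the first coordinate to vanish belongs to a point of that part.
\<close>
lemma circuit_split_hull:
  assumes c: "circuit P d c" and z: "z \<in> convex hull (pos c \<union> neg c)"
  shows "\<exists>b\<in>pos c. z \<in> convex hull (pos c \<union> neg c - {b})"
proof -
  obtain w where w: "barycentric P w z" "pos w \<subseteq> pos c \<union> neg c"
    using hull_imp_barycentric[OF finite_P circuit_supp[OF c] z] by blast
  have rel: "affine_relation P c" using c by (simp add: circuit_def)
  have nn: "0 \<le> w v" for v using w(1) by (simp add: barycentric_def)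
  have ne: "pos c \<noteq> {}" using c unfolding circuit_def by (metis add_is_0 card.empty one_neq_zero)
  obtain b where b: "b \<in> pos c" "\<And>y. y \<in> pos c \<Longrightarrow> w b / c b \<le> w y / c y"
    by (rule finite_minimizer[OF finite_pos(1)[OF rel] ne, of "\<lambda>y. w y / c y"]) blast
  define t where "t = w b / c b"
  have t: "0 \<le> t" using b(1) nn by (simp add: t_def)
  have ge: "0 \<le> w v - t * c v" for v
  proof (cases "v \<in> pos c")
    case True
    then have "t \<le> w v / c v" using b(2) by (simp add: t_def)
    then show ?thesis using True by (simp add: field_simps)
  next
    case False
    then have "t * c v \<le> 0" using t by (simp add: mult_nonneg_nonpos)
    then show ?thesis using nn[of v] by linarith
  qed
  have "pos (\<lambda>v. w v - t * c v) \<subseteq> pos c \<union> neg c - {b}"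
  proof
    fix v assume v: "v \<in> pos (\<lambda>v. w v - t * c v)"
    have "v \<noteq> b" using v b(1) by (auto simp: t_def)
    moreover have "v \<in> pos c \<union> neg c"
    proof (rule ccontr)
      assume "v \<notin> pos c \<union> neg c"
      then have "c v = 0" "\<not> 0 < w v" using w(2) by auto
      with v show False by simp
    qed
    ultimately show "v \<in> pos c \<union> neg c - {b}" by simp
  qed
  then show ?thesis using b(1) barycentric_imp_hull[OF finite_P barycentric_shift[OF w(1) rel ge]] by blast
qed

lemma affine_hull_full:
  assumes "X \<subseteq> P" "2 * d + 1 \<le> card X" shows "affine hull X = UNIV"
proof -
  obtain Y where Y: "Y \<subseteq> X" "card Y = 2 * d + 1" using obtain_subset_with_card_n[OF assms(2)] by blast
  then have "\<not> affine_dependent Y" using affine_independent assms(1) by simp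
  then have "affine hull Y = UNIV" by (rule affine_independent_span_eq) (simp add: Y dim)
  then show ?thesis using hull_mono[OF Y(1), of affine] by auto
qed

lemma barycentric_rel_interior:
  assumes "barycentric P w z" "pos w = C" "C \<subseteq> P"
  shows "z \<in> rel_interior (convex hull C)"
proof -
  have fC: "finite C" using assms finite_subset_P by blast
  have z: "w v = 0" if "v \<notin> C" for v
  proof -
    have "0 \<le> w v" using assms(1) by (simp add: barycentric_def)
    moreover have "\<not> 0 < w v" using assms(2) that by auto
    ultimately show ?thesis by simp
  qed
  have "(\<Sum>v\<in>P. w v) = (\<Sum>v\<in>C. w v)" "(\<Sum>v\<in>P. w v *\<^sub>R v) = (\<Sum>v\<in>C. w v *\<^sub>R v)"
    by (rule sum.mono_neutral_right[OF finite_P assms(3)]; simp add: z)+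
  then show ?thesis
    using explicit_subset_rel_interior_convex_hull_minimal[OF fC] assms(1,2) unfolding barycentric_def by auto
qed

lemma circuit_center:
  assumes "circuit P d c"
  obtains s z where "0 < s" "barycentric P (\<lambda>v. max 0 (c v) / s) z"
    "barycentric P (\<lambda>v. max 0 (- c v) / s) z"
    "pos (\<lambda>v. max 0 (c v) / s) = pos c" "pos (\<lambda>v. max 0 (- c v) / s) = neg c"
proof -
  obtain s z where s: "0 < s" "barycentric P (\<lambda>v. max 0 (c v) / s) z"
    "barycentric P (\<lambda>v. max 0 (- c v) / s) z"
    using relation_crossing_point[OF finite_P _ circuit_nonzero[OF assms]] assms
    unfolding circuit_def by blast
  moreover have "pos (\<lambda>v. max 0 (c v) / s) = pos c" "pos (\<lambda>v. max 0 (- c v) / s) = neg c"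
    using s(1) by (auto simp: zero_less_divide_iff max_def split: if_splits)
  ultimately show ?thesis using that by blast
qed

text \<open>
  A cell inside the hull of the circuit has all of its points there. A cell that contains the negative
  part has, close to the crossing point of the two parts, points
  in its relative interior that still lie in the hull of the circuit, because the crossing point is
  interior to that hull. The simplices filling the hull also contain these points, and uniqueness of
  coordinates makes the cell equal to one of them.
\<close>
lemma filled_circuit_cells:
  assumes S: "triangulates S Q P" and c: "circuit P d c"
    and filled: "\<And>b. b \<in> pos c \<Longrightarrow> pos c \<union> neg c - {b} \<in> cells P S"
    and C: "C \<in> cells P S" "neg c \<subseteq> C \<or> convex hull C \<subseteq> convex hull (pos c \<union> neg c)"
  shows "\<exists>b\<in>pos c. C = pos c \<union> neg c - {b}"
proof -
  let ?X = "pos c \<union> neg c"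
  have CP: "C \<subseteq> P" "card C = 2 * d + 1" using cells_D[OF C(1)] by auto
  then have "C \<noteq> {}" by auto
  then obtain w y where w: "barycentric P w y" "pos w = C"
    using barycentric_exists_pos[OF finite_P CP(1)] by blast
  have "\<exists>w z. barycentric P w z \<and> pos w = C \<and> z \<in> convex hull ?X"
  proof (cases "neg c \<subseteq> C")
    case False
    then show ?thesis using C(2) w barycentric_imp_hull[OF finite_P w(1)] by blast
  next
    case True
    obtain s q where s: "0 < s" "barycentric P (\<lambda>v. max 0 (c v) / s) q" "barycentric P (\<lambda>v. max 0 (- c v) / s) q"
      "pos (\<lambda>v. max 0 (c v) / s) = pos c" "pos (\<lambda>v. max 0 (- c v) / s) = neg c"
      by (rule circuit_center[OF c])
    \<comment> \<open>The mean of the two representations of the crossing point is positive on all of \<open>?X\<close>.\<close>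
    define wm where "wm = (\<lambda>v. (1 - 1/2) * (max 0 (c v) / s) + 1/2 * (max 0 (- c v) / s))"
    have "barycentric P wm ((1 - 1/2) *\<^sub>R q + (1/2) *\<^sub>R q)"
      unfolding wm_def by (rule barycentric_combine[OF s(2,3)]) auto
    then have "barycentric P wm q" by (simp flip: scaleR_add_left)
    moreover have "pos wm = ?X" using s(1) by (auto simp: wm_def max_def field_simps split: if_splits)
    ultimately have "q \<in> rel_interior (convex hull ?X)"
      using barycentric_rel_interior circuit_supp[OF c] by blast
    moreover have "affine hull (convex hull ?X) = UNIV"
      using affine_hull_full[OF circuit_supp[OF c]] circuit_card[OF c] by simp
    ultimately have "q \<in> interior (convex hull ?X)" using rel_interior_interior by blast
    then obtain e where e: "0 < e" "ball q e \<subseteq> convex hull ?X" using mem_interior by blast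
    define n where "n = norm (y - q)"
    define t where "t = min 1 (e / (n + 1))"
    have n: "0 \<le> n" by (simp add: n_def)
    have t: "0 < t" "t \<le> 1" using e(1) n by (auto simp: t_def)
    have "t * n \<le> e / (n + 1) * n" using n by (intro mult_right_mono) (auto simp: t_def)
    also have "\<dots> < e" using e(1) n by (simp add: field_simps)
    finally have tn: "t * n < e" .
    have "(1 - t) *\<^sub>R q + t *\<^sub>R y = q + t *\<^sub>R (y - q)" by (simp add: algebra_simps)
    then have "dist q ((1 - t) *\<^sub>R q + t *\<^sub>R y) = t * n" using t by (simp add: dist_norm n_def)
    then have "(1 - t) *\<^sub>R q + t *\<^sub>R y \<in> convex hull ?X" using tn e(2) by auto
    moreover have "barycentric P (\<lambda>v. (1 - t) * (max 0 (- c v) / s) + t * w v) ((1 - t) *\<^sub>R q + t *\<^sub>R y)"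
      using t by (intro barycentric_combine s w) auto
    moreover have "pos (\<lambda>v. (1 - t) * (max 0 (- c v) / s) + t * w v) = C"
    proof (intro equalityI subsetI CollectI)
      fix v assume "v \<in> C"
      then have "0 < t * w v" using w t by auto
      moreover have "0 \<le> (1 - t) * (max 0 (- c v) / s)" using t s(1) by simp
      ultimately show "0 < (1 - t) * (max 0 (- c v) / s) + t * w v" by linarith
    next
      fix v assume v: "v \<in> pos (\<lambda>v. (1 - t) * (max 0 (- c v) / s) + t * w v)"
      show "v \<in> C"
      proof (rule ccontr)
        assume "v \<notin> C"
        then have "0 \<le> c v" "\<not> 0 < w v" using True w(2) by (auto simp: not_less[symmetric])
        moreover have "0 \<le> w v" using w(1) by (simp add: barycentric_def)
        ultimately show False using v by simp
      qed
    qed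
    ultimately show ?thesis by blast
  qed
  then obtain w z where w: "barycentric P w z" "pos w = C" "z \<in> convex hull ?X" by blast
  then obtain b where b: "b \<in> pos c" "z \<in> convex hull (?X - {b})" using circuit_split_hull[OF c] by blast
  note D = filled[OF b(1)]
  obtain w' where w': "barycentric P w' z" "pos w' \<subseteq> ?X - {b}"
    using hull_imp_barycentric[OF finite_P _ b(2)] cells_D[OF D] by blast
  have "w = w'" using cell_weights_unique[OF S C(1) D w(1) _ w'] w(2) by blast
  then have "C \<subseteq> ?X - {b}" using w(2) w'(2) by simp
  moreover have "card (?X - {b}) = card C" using CP(2) cells_D[OF D] by simp
  ultimately have "C = ?X - {b}" using cells_D[OF D] card_subset_eq[OF finite_subset_P] by metis
  then show ?thesis using b(1) by blast
qed

lemma filled_circuit_triangulates: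
  assumes S: "triangulates S Q P" and c: "circuit P d c"
    and filled: "\<And>b. b \<in> pos c \<Longrightarrow> pos c \<union> neg c - {b} \<in> cells P S"
  defines "X \<equiv> pos c \<union> neg c"
  shows "{\<sigma>\<in>S. \<sigma> \<subseteq> convex hull X} = (\<lambda>b. convex hull (X - {b})) ` pos c" (is ?eq)
    and "triangulates {\<sigma>\<in>S. \<sigma> \<subseteq> convex hull X} (convex hull X) X" (is ?tri)
proof -
  show eq: ?eq
  proof (intro equalityI subsetI)
    fix \<sigma> assume s: "\<sigma> \<in> {\<sigma>\<in>S. \<sigma> \<subseteq> convex hull X}"
    then obtain C where C: "C \<in> cells P S" "\<sigma> = convex hull C" using triangulates_cell[OF S] by blast
    then have "\<exists>b\<in>pos c. C = X - {b}"
      unfolding X_def using filled_circuit_cells[OF S c filled C(1)] s by (auto simp: X_def)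
    then show "\<sigma> \<in> (\<lambda>b. convex hull (X - {b})) ` pos c" using C by blast
  next
    fix \<sigma> assume "\<sigma> \<in> (\<lambda>b. convex hull (X - {b})) ` pos c"
    then obtain b where b: "b \<in> pos c" "\<sigma> = convex hull (X - {b})" by blast
    then have "\<sigma> \<in> S" using cells_D[OF filled[OF b(1)]] by (simp add: X_def)
    moreover have "\<sigma> \<subseteq> convex hull X" unfolding b(2) by (rule hull_mono) auto
    ultimately show "\<sigma> \<in> {\<sigma>\<in>S. \<sigma> \<subseteq> convex hull X}" by simp
  qed
  let ?U = "{\<sigma>\<in>S. \<sigma> \<subseteq> convex hull X}"
  have trS: "triangulation S" using S by (simp add: triangulates_def)
  then have "triangulation ?U" unfolding triangulation_def by auto
  moreover have "\<Union>?U = convex hull X"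
  proof
    show "convex hull X \<subseteq> \<Union>?U"
      using circuit_split_hull[OF c] unfolding eq by (auto simp: X_def)
  qed auto
  moreover have "int DIM('a) simplex \<sigma> \<and> {v. v extreme_point_of \<sigma>} \<subseteq> X" if "\<sigma> \<in> ?U" for \<sigma>
  proof
    show "int DIM('a) simplex \<sigma>" using S that by (simp add: triangulates_def)
    obtain b where "\<sigma> = convex hull (X - {b})" using \<open>\<sigma> \<in> ?U\<close> unfolding eq by blast
    then show "{v. v extreme_point_of \<sigma>} \<subseteq> X" using extreme_point_of_convex_hull by blast
  qed
  ultimately show ?tri unfolding triangulates_def by blast
qed

text \<open>
  Every circuit contained in such a relation has the positive part of \<open>c\<close> as its positive part, and
  its negative part is a \<open>d\<close>-face crossing it, hence the negative part of \<open>c\<close>. So a nonzero relation of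
  this kind is nonzero on the whole support of \<open>c\<close>. Subtracting the largest multiple of \<open>c\<close> that
  respects the signs leaves a relation of the same kind with a zero on that support, which must
  therefore be 0.
\<close>
lemma relation_on_single_crossing:
  assumes c: "circuit P d c"
    and single: "\<And>c'. circuit P d c' \<Longrightarrow> pos c' = pos c \<Longrightarrow> neg c' \<in> mid_faces P d S \<Longrightarrow> neg c' = neg c"
    and C: "C \<in> cells P S"
    and u: "affine_relation P u" "pos u \<subseteq> pos c" "neg u \<subseteq> C"
  shows "\<exists>t. u = (\<lambda>v. t * c v)"
proof -
  have rel: "affine_relation P c" using c by (simp add: circuit_def)
  have full: "pos u' = pos c \<and> neg c \<subseteq> neg u'"
    if u': "affine_relation P u'" "u' \<noteq> (\<lambda>_. 0)" "pos u' \<subseteq> pos c" "neg u' \<subseteq> C" for u'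
  proof -
    obtain c' where c': "circuit P d c'" "pos c' \<subseteq> pos u'" "neg c' \<subseteq> neg u'"
      using contains_circuit[OF u'(1,2)] by blast
    have p: "pos c' = pos c"
      using c c' u'(3) by (intro card_subset_eq finite_pos[OF rel]) (auto simp: circuit_def)
    have "neg c' \<in> mid_faces P d S"
      using c' u'(4) C unfolding mid_faces_def circuit_def by blast
    then have "neg c' = neg c" using single[OF c'(1) p] by blast
    then show ?thesis using p c' u'(3) by blast
  qed
  show ?thesis
  proof (cases "u = (\<lambda>_. 0)")
    case True
    then show ?thesis by (intro exI[of _ 0]) simp
  next
    case False
    from full[OF u(1) False u(2,3)] have fu: "pos u = pos c" "neg c \<subseteq> neg u" by auto
    let ?X = "pos c \<union> neg c"
    have "finite ?X" using finite_pos[OF rel] by simp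
    moreover have "?X \<noteq> {}" using circuit_card[OF c] by (metis add_is_0 card.empty zero_neq_numeral)
    ultimately obtain x where x: "x \<in> ?X" "\<And>y. y \<in> ?X \<Longrightarrow> u x / c x \<le> u y / c y"
      by (rule finite_minimizer[where f="\<lambda>y. u y / c y"]) blast
    define t where "t = u x / c x"
    define u' where "u' = (\<lambda>v. u v - t * c v)"
    have rel': "affine_relation P u'" unfolding u'_def by (rule affine_relation_diff[OF u(1) rel])
    have tp: "0 < t" using x(1) fu unfolding t_def by (auto intro: divide_pos_pos divide_neg_neg)
    have s1: "pos u' \<subseteq> pos c"
    proof
      fix v assume v: "v \<in> pos u'"
      show "v \<in> pos c"
      proof (rule ccontr)
        assume n: "v \<notin> pos c"
        then have le: "u v \<le> 0" using fu(1) by auto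
        show False
        proof (cases "c v = 0")
          case True
          then show False using v le by (simp add: u'_def)
        next
          case False
          then have neg: "c v < 0" using n by auto
          then have "t \<le> u v / c v" using x(2) by (simp add: t_def)
          then have "u v \<le> t * c v" using neg by (simp add: neg_le_divide_eq)
          then show False using v by (simp add: u'_def)
        qed
      qed
    qed
    have s2: "neg u' \<subseteq> C"
    proof
      fix v assume v: "v \<in> neg u'"
      have "v \<in> neg u"
      proof (rule ccontr)
        assume n: "v \<notin> neg u"
        then have ge: "0 \<le> c v" using fu(2) by (meson mem_Collect_eq not_less subsetD)
        show False
        proof (cases "c v = 0")
          case True
          then show False using v n by (simp add: u'_def)
        next
          case False
          then have p: "0 < c v" using ge by simp
          then have "t \<le> u v / c v" using x(2) by (simp add: t_def)
          then have "t * c v \<le> u v" using p by (simp add: pos_le_divide_eq)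
          then show False using v by (simp add: u'_def)
        qed
      qed
      then show "v \<in> C" using u(3) by blast
    qed
    have "u' x = 0" using x(1) by (auto simp: u'_def t_def)
    have "\<not> (pos u' = pos c \<and> neg c \<subseteq> neg u')"
    proof
      assume "pos u' = pos c \<and> neg c \<subseteq> neg u'"
      then have "x \<in> pos u' \<union> neg u'" using x(1) by blast
      with \<open>u' x = 0\<close> show False by simp
    qed
    then have "u' = (\<lambda>_. 0)" using full[OF rel' _ s1 s2] by blast
    then show ?thesis unfolding u'_def by (metis eq_iff_diff_eq_0)
  qed
qed

text \<open>
  The test point is chosen in the relative interior of the positive part, displaced from the
  crossing point towards the face opposite to \<open>b\<close>. The displacement makes \<open>b\<close> the first coordinate
  to vanish when \<open>c\<close> is subtracted, and the coordinates of the point in its cell arise in this way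
  because they differ from those in the positive part by a multiple of \<open>c\<close>.
\<close>
lemma single_crossing_filled:
  assumes S: "triangulates S (convex hull P) P" and c: "circuit P d c"
    and face: "neg c \<in> mid_faces P d S"
    and single: "\<And>c'. circuit P d c' \<Longrightarrow> pos c' = pos c \<Longrightarrow> neg c' \<in> mid_faces P d S \<Longrightarrow> neg c' = neg c"
    and b: "b \<in> pos c"
  shows "pos c \<union> neg c - {b} \<in> cells P S"
proof -
  let ?X = "pos c \<union> neg c"
  have rel: "affine_relation P c" using c by (simp add: circuit_def)
  have XP: "?X \<subseteq> P" using circuit_supp[OF c] .
  obtain s q where s: "0 < s" "barycentric P (\<lambda>v. max 0 (c v) / s) q" "barycentric P (\<lambda>v. max 0 (- c v) / s) q"
    "pos (\<lambda>v. max 0 (c v) / s) = pos c" "pos (\<lambda>v. max 0 (- c v) / s) = neg c"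
    by (rule circuit_center[OF c])
  have "card (pos c - {b}) = d" using b c by (simp add: circuit_def)
  then have "pos c - {b} \<noteq> {}" using d_pos by (metis card.empty not_one_le_zero)
  then obtain e y where e: "barycentric P e y" "pos e = pos c - {b}"
    using barycentric_exists_pos[OF finite_P, of "pos c - {b}"] XP by blast
  have e0: "0 \<le> e v" for v using e(1) by (simp add: barycentric_def)
  have eb: "e v = 0" if "v \<notin> pos c - {b}" for v using e0[of v] e(2) that by force
  define w where "w = (\<lambda>v. (1 - 1/2) * (max 0 (c v) / s) + 1/2 * e v)"
  define z where "z = (1 - 1/2) *\<^sub>R q + (1/2) *\<^sub>R y"
  have wz: "barycentric P w z" unfolding w_def z_def by (rule barycentric_combine[OF s(2) e(1)]) auto
  have "pos w \<subseteq> ?X"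
  proof
    fix v assume "v \<in> pos w"
    then have "w v \<noteq> 0" by simp
    then have "v \<in> pos c" using eb[of v] unfolding w_def by (cases "0 < c v") auto
    then show "v \<in> ?X" by simp
  qed
  then have "z \<in> convex hull P" using barycentric_imp_hull[OF finite_P wz] XP by blast
  then obtain C w' where C: "C \<in> cells P S" "barycentric P w' z" "pos w' \<subseteq> C"
    using cell_weights_exist[OF S] by blast
  have w'0: "0 \<le> w' v" for v using C(2) by (simp add: barycentric_def)
  have wpos: "w v = 0" if "v \<notin> pos c" for v using that eb[of v] by (simp add: w_def)
  have w0: "0 \<le> w v" for v using wz by (simp add: barycentric_def)
  have "pos (\<lambda>v. w v - w' v) \<subseteq> pos c"
  proof
    fix v assume v: "v \<in> pos (\<lambda>v. w v - w' v)"
    show "v \<in> pos c"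
    proof (rule ccontr)
      assume "v \<notin> pos c"
      then show False using wpos[of v] w'0[of v] v by simp
    qed
  qed
  moreover have "neg (\<lambda>v. w v - w' v) \<subseteq> C"
  proof
    fix v assume "v \<in> neg (\<lambda>v. w v - w' v)"
    then have "0 < w' v" using w0[of v] by simp
    then show "v \<in> C" using C(3) by auto
  qed
  ultimately obtain t where t: "(\<lambda>v. w v - w' v) = (\<lambda>v. t * c v)"
    using relation_on_single_crossing[OF c single C(1) barycentric_diff[OF wz C(2)]] by blast
  then have w': "w' v = w v - t * c v" for v by (metis add_diff_cancel_left' diff_add_cancel)
  have "neg c \<noteq> {}" using c unfolding circuit_def by (metis add_is_0 card.empty one_neq_zero)
  then obtain a where a: "c a < 0" by auto
  have "0 \<le> - (t * c a)" using w'0[of a] w'[of a] wpos[of a] a by simp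
  then have t0: "0 \<le> t" using a by (simp add: mult_le_0_iff)
  have "t \<noteq> 0"
  proof
    assume "t = 0"
    then have "pos c \<subseteq> pos w'" using e0 s(1) w' by (auto simp: w_def add_pos_nonneg)
    then have "pos c \<in> mid_faces P d S" using C c unfolding mid_faces_def circuit_def by blast
    then show False using mid_faces_no_crossing[OF S c] face by blast
  qed
  then have tp: "0 < t" using t0 by simp
  \<comment> \<open>The coordinate at \<open>b\<close> bounds \<open>t\<close>; all the other points of the positive part keep the positive
    contribution of \<open>e\<close>.\<close>
  have "0 \<le> c b / (2 * s) - t * c b" using w'0[of b] w'[of b] eb[of b] b by (simp add: w_def field_simps)
  then have tb: "t \<le> 1 / (2 * s)" using b s(1) by (simp add: field_simps)
  have "?X - {b} \<subseteq> C"
  proof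
    fix v assume v: "v \<in> ?X - {b}"
    have "0 < w' v"
    proof (cases "v \<in> pos c")
      case True
      then have "0 < e v" using v e(2) by auto
      moreover have "t * c v \<le> 1 / (2 * s) * c v" using True tb by (intro mult_right_mono) auto
      moreover have "w' v = c v / (2 * s) + e v / 2 - t * c v"
        using w'[of v] True by (simp add: w_def)
      ultimately show ?thesis by simp
    next
      case False
      then have "c v < 0" using v by auto
      then have "t * c v < 0" using tp by (simp add: mult_pos_neg)
      then show ?thesis using w'[of v] wpos[OF False] by simp
    qed
    then show "v \<in> C" using C(3) by blast
  qed
  moreover have "card (?X - {b}) = card C"
    using b circuit_card[OF c] cells_D[OF C(1)] finite_pos[OF rel] by simp
  ultimately have "?X - {b} = C" using card_subset_eq[OF finite_subset_P] cells_D[OF C(1)] by metis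
  then show ?thesis using C(1) by simp
qed

text \<open>
  All \<open>d\<close>-faces of a cell of \<open>T\<close> that does not contain \<open>B\<close> are \<open>d\<close>-faces of \<open>S\<close> as well.
\<close>
lemma cell_transfer:
  assumes "triangulates S (convex hull P) P" "mid_faces P d T - mid_faces P d S = {B}"
    and "C \<in> cells P T" "\<not> B \<subseteq> C"
  shows "C \<in> cells P S"
proof (rule triangulation_determined_by_mid_faces[OF assms(1)])
  show "C \<subseteq> P" "card C = 2 * d + 1" using cells_D[OF assms(3)] by auto
  fix A assume A: "A \<subseteq> C" "card A = d + 1"
  then have "A \<in> mid_faces P d T" using assms(3) unfolding mid_faces_def by blast
  then show "A \<in> mid_faces P d S" using A assms(2,4) by blast
qed

text \<open>
  The faces \<open>A\<close> and \<open>B\<close> form a circuit because \<open>A\<close>, not being a face of \<open>T\<close>, is crossed by a \<open>d\<close>-face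
  of \<open>T\<close>, and that face cannot belong to \<open>S\<close>. For the same reason neither is crossed by a further
  \<open>d\<close>-face of the other triangulation, so both triangulations fill the hull of \<open>A \<union> B\<close>. Outside of
  it no cell contains \<open>A\<close> or \<open>B\<close>.
\<close>
theorem exchange_imp_flip:
  assumes S: "triangulates S (convex hull P) P" and T: "triangulates T (convex hull P) P"
    and A: "mid_faces P d S - mid_faces P d T = {A}"
    and B: "mid_faces P d T - mid_faces P d S = {B}"
  shows "bistellar_flip S T"
proof -
  have AS: "A \<in> mid_faces P d S" "A \<notin> mid_faces P d T" using A by auto
  have onlyA: "F = A" if "F \<in> mid_faces P d S" "F \<notin> mid_faces P d T" for F
    using that A by (metis DiffI singletonD)
  have onlyB: "F = B" if "F \<in> mid_faces P d T" "F \<notin> mid_faces P d S" for F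
    using that B by (metis DiffI singletonD)
  then obtain c where c: "circuit P d c" "pos c = A" "neg c \<in> mid_faces P d T"
    using mid_face_nonface_crossed[OF T AS] by auto
  have nS: "neg c \<notin> mid_faces P d S" using mid_faces_no_crossing[OF S c(1)] AS(1) c(2) by simp
  then have nB: "neg c = B" using onlyB c(3) by simp
  let ?X = "pos c \<union> neg c"
  define c' where "c' = (\<lambda>v. - c v)"
  have c': "circuit P d c'" "pos c' = neg c" "neg c' = pos c"
    using circuit_uminus[OF c(1)] by (auto simp: c'_def)
  have fT: "?X - {a} \<in> cells P T" if "a \<in> pos c" for a
  proof (rule single_crossing_filled[OF T c(1,3) _ that])
    fix u assume u: "circuit P d u" "pos u = pos c" "neg u \<in> mid_faces P d T"
    have "neg u \<notin> mid_faces P d S" using mid_faces_no_crossing[OF S u(1)] AS(1) c(2) u(2) by simp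
    then show "neg u = neg c" using u(3) onlyB nB by simp
  qed
  have fS: "pos c' \<union> neg c' - {b} \<in> cells P S" if "b \<in> pos c'" for b
  proof (rule single_crossing_filled[OF S c'(1) _ _ that])
    show "neg c' \<in> mid_faces P d S" using c'(3) c(2) AS(1) by simp
    fix u assume u: "circuit P d u" "pos u = pos c'" "neg u \<in> mid_faces P d S"
    have "neg u \<notin> mid_faces P d T" using mid_faces_no_crossing[OF T u(1)] u(2) c'(2) c(3) by simp
    then show "neg u = neg c'" using u(3) onlyA c'(3) c(2) by simp
  qed
  have X': "pos c' \<union> neg c' = ?X" using c' by auto
  note rS = filled_circuit_triangulates[OF S c'(1) fS, unfolded X']
  note rT = filled_circuit_triangulates[OF T c(1) fT]
  let ?SX = "{\<sigma>\<in>S. \<sigma> \<subseteq> convex hull ?X}" and ?TX = "{\<sigma>\<in>T. \<sigma> \<subseteq> convex hull ?X}"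
  have outer_T: "\<sigma> \<in> S" if s: "\<sigma> \<in> T" "\<not> \<sigma> \<subseteq> convex hull ?X" for \<sigma>
  proof -
    obtain C where C: "C \<in> cells P T" "\<sigma> = convex hull C" using triangulates_cell[OF T s(1)] .
    have "\<not> neg c \<subseteq> C"
    proof
      assume "neg c \<subseteq> C"
      then obtain a where "C = ?X - {a}" using filled_circuit_cells[OF T c(1) fT C(1)] by blast
      then have "\<sigma> \<subseteq> convex hull ?X" unfolding C(2) by (intro hull_mono) auto
      with s(2) show False by blast
    qed
    then have "C \<in> cells P S" using cell_transfer[OF S B C(1)] nB by blast
    then show ?thesis using C(2) cells_D by simp
  qed
  have outer_S: "\<sigma> \<in> T" if s: "\<sigma> \<in> S" "\<not> \<sigma> \<subseteq> convex hull ?X" for \<sigma>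
  proof -
    obtain C where C: "C \<in> cells P S" "\<sigma> = convex hull C" using triangulates_cell[OF S s(1)] .
    have "\<not> neg c' \<subseteq> C"
    proof
      assume "neg c' \<subseteq> C"
      then obtain a where "C = ?X - {a}" using filled_circuit_cells[OF S c'(1) fS C(1)] X' by metis
      then have "\<sigma> \<subseteq> convex hull ?X" unfolding C(2) by (intro hull_mono) auto
      with s(2) show False by blast
    qed
    then have "C \<in> cells P T" using cell_transfer[OF T A C(1)] c'(3) c(2) by blast
    then show ?thesis using C(2) cells_D by simp
  qed
  show ?thesis unfolding bistellar_flip_def
  proof (intro exI[of _ ?X] conjI allI impI exI[of _ ?TX])
    show "?X \<subseteq> {v. \<exists>\<sigma>\<in>S. v extreme_point_of \<sigma>}"
    proof
      fix v assume v: "v \<in> ?X"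
      have "card (neg c - {v}) \<ge> d" using c(1) card_Diff1_le diff_card_le_card_Diff[of "{v}" "neg c"]
        by (simp add: circuit_def)
      then have "neg c - {v} \<noteq> {}" using d_pos by (metis card.empty le_zero_eq not_one_le_zero)
      then obtain b where b: "b \<in> neg c" "b \<noteq> v" by blast
      then have D: "?X - {b} \<in> cells P S" using fS X' c'(2) by metis
      have "v extreme_point_of convex hull (?X - {b})"
        using extreme_point_of_convex_hull_affine_independent[OF cell_independent[OF D]] v b by blast
      then show "v \<in> {v. \<exists>\<sigma>\<in>S. v extreme_point_of \<sigma>}" using cells_D[OF D] by blast
    qed
    show "card ?X = DIM('a) + 2" using circuit_card[OF c(1)] dim by simp
    fix W assume W: "W \<subseteq> ?X" "card W = DIM('a) + 1"
    show "\<not> (\<exists>a b. a \<noteq> 0 \<and> W \<subseteq> {x. a \<bullet> x = b})"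
    proof
      assume "\<exists>a b. a \<noteq> 0 \<and> W \<subseteq> {x. a \<bullet> x = b}"
      then obtain a b where ab: "a \<noteq> 0" "W \<subseteq> {x. a \<bullet> x = b}" by blast
      have "W \<subseteq> P" using W circuit_supp[OF c(1)] by blast
      then have "affine hull W = UNIV" using affine_hull_full W(2) dim by simp
      then have "aff_dim W = int DIM('a)" by (metis aff_dim_UNIV aff_dim_affine_hull)
      moreover have "aff_dim W \<le> aff_dim {x. a \<bullet> x = b}" using ab(2) by (rule aff_dim_subset)
      ultimately show False using aff_dim_hyperplane[OF ab(1), of b] by simp
    qed
  next
    show "triangulates ?SX (convex hull ?X) ?X" by (rule rS(2))
    show "triangulates ?TX (convex hull ?X) ?X" by (rule rT(2))
    show "?TX \<noteq> ?SX"
    proof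
      assume eq: "?TX = ?SX"
      obtain a where a: "a \<in> pos c" using c(1) unfolding circuit_def
        by (metis add_is_0 card.empty ex_in_conv one_neq_zero)
      have "convex hull (?X - {a}) \<in> ?TX" using rT(1) a by blast
      then have "convex hull (?X - {a}) \<in> S" using eq by blast
      then have "?X - {a} \<in> cells P S" using cells_D[OF fT[OF a]] by (simp add: cells_def dim)
      moreover have "neg c \<subseteq> ?X - {a}" using a by auto
      ultimately have "neg c \<in> mid_faces P d S" using c(1) unfolding mid_faces_def circuit_def by blast
      then show False using nS by blast
    qed
    show "T = (S - ?SX) \<union> ?TX" using outer_S outer_T by blast
  qed
qed

section \<open>From a flip to an exchanged face\<close>

text \<open>
  The barycentre of \<open>P - {x}\<close> lies in some cell \<open>P - {x'}\<close>, and its coordinates there arise by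
  subtracting a multiple of \<open>c\<close>. Nonnegativity at \<open>x\<close> forbids a positive multiple, while
  vanishing at \<open>x'\<close> requires one unless \<open>x = x'\<close>.
\<close>
lemma simplex_circuit_cells:
  assumes U: "triangulates U (convex hull P) P" and c: "circuit P d c" "pos c \<union> neg c = P"
    and sub: "cells P U \<subseteq> (\<lambda>x. P - {x}) ` pos c"
  shows "cells P U = (\<lambda>x. P - {x}) ` pos c"
proof (intro equalityI sub subsetI)
  fix D assume "D \<in> (\<lambda>x. P - {x}) ` pos c"
  then obtain x where x: "0 < c x" "D = P - {x}" by auto
  have "card P = 2 * d + 2" using circuit_card[OF c(1)] c(2) by simp
  moreover have "x \<in> P" using x c(2) by auto
  ultimately have "card D = 2 * d + 1" using x(2) finite_P by simp
  then have "D \<noteq> {}" by auto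
  then obtain w z where w: "barycentric P w z" "pos w = D"
    using barycentric_exists_pos[OF finite_P, of D] x(2) by blast
  then have "z \<in> convex hull P" using barycentric_imp_hull[OF finite_P w(1)] x(2) by blast
  then obtain C w' where C: "C \<in> cells P U" "barycentric P w' z" "pos w' \<subseteq> C"
    using cell_weights_exist[OF U] by blast
  then obtain x' where x': "0 < c x'" "C = P - {x'}" using sub by auto
  have nn: "0 \<le> w v" "0 \<le> w' v" for v using w(1) C(2) by (auto simp: barycentric_def)
  have "w v - w' v = 0" if "c v = 0" for v
  proof -
    have "v \<notin> P" using that c(2) by auto
    then show ?thesis using w(1) C(2) by (simp add: barycentric_def)
  qed
  then obtain t where "(\<lambda>v. w v - w' v) = (\<lambda>v. t * c v)"
    using relation_on_circuit_support[OF c(1) barycentric_diff[OF w(1) C(2)]] by blast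
  then have t: "w v - w' v = t * c v" for v by metis
  have "w x = 0" using w(2) x(2) nn(1)[of x] by force
  then have "t * c x \<le> 0" using t[of x] nn(2)[of x] by linarith
  then have t0: "t \<le> 0" using x(1) by (simp add: mult_le_0_iff)
  have "x = x'"
  proof (rule ccontr)
    assume "x \<noteq> x'"
    then have "x' \<in> D" using x' x c(2) by auto
    then have "0 < w x'" using w(2) by auto
    moreover have "w' x' = 0" using C(3) x'(2) nn(2)[of x'] by force
    ultimately have "0 < t * c x'" using t[of x'] by simp
    then show False using t0 x'(1) by (simp add: zero_less_mult_iff)
  qed
  then show "D \<in> cells P U" using C(1) x x' by simp
qed

text \<open>
  A cell omits exactly one point, so it contains one of the two parts of the circuit. Cells of
  both kinds cannot occur together, since the two parts cross.
\<close>
lemma two_triangulations: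
  assumes U: "triangulates U (convex hull P) P" and c: "circuit P d c" "pos c \<union> neg c = P"
  shows "cells P U = (\<lambda>x. P - {x}) ` pos c \<or> cells P U = (\<lambda>x. P - {x}) ` neg c"
proof -
  define c' where "c' = (\<lambda>v. - c v)"
  have c': "circuit P d c'" "pos c' = neg c" "neg c' = pos c" "pos c' \<union> neg c' = P"
    using circuit_uminus[OF c(1)] c(2) by (auto simp: c'_def)
  have cP: "card P = 2 * d + 2" using circuit_card[OF c(1)] c(2) by simp
  have cell: "\<exists>x\<in>pos c \<union> neg c. C = P - {x}" if "C \<in> cells P U" for C
  proof -
    have C: "C \<subseteq> P" "card C = 2 * d + 1" using cells_D[OF that] by auto
    then have "card (P - C) = 1" using cP card_Diff_subset[OF finite_subset_P[OF C(1)] C(1)] by simp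
    then obtain x where "P - C = {x}" using card_1_singletonE by blast
    then show ?thesis using C(1) c(2) by blast
  qed
  have dis: "pos c \<inter> neg c = {}" by auto
  have excl: "P - {x} \<in> cells P U \<Longrightarrow> P - {y} \<notin> cells P U" if "x \<in> pos c" "y \<in> neg c" for x y
  proof
    assume "P - {x} \<in> cells P U" "P - {y} \<in> cells P U"
    moreover have "neg c \<subseteq> P - {x}" "pos c \<subseteq> P - {y}" using that c(2) by auto
    ultimately show False
      using no_crossing[OF U _ _ _ circuit_nonzero[OF c(1)]] c(1) unfolding circuit_def by blast
  qed
  show ?thesis
  proof (cases "\<exists>y\<in>neg c. P - {y} \<in> cells P U")
    case False
    then have "cells P U \<subseteq> (\<lambda>x. P - {x}) ` pos c" using cell by blast
    then show ?thesis using simplex_circuit_cells[OF U c] by blast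
  next
    case True
    then have "cells P U \<subseteq> (\<lambda>x. P - {x}) ` neg c" using cell excl by blast
    then show ?thesis using simplex_circuit_cells[OF U c'(1,4)] c'(2) by simp
  qed
qed

lemma triangulates_eq_image: "triangulates S Q P \<Longrightarrow> S = (hull) convex ` cells P S"
  using triangulates_cell[of S Q] cells_D by blast

text \<open>
  One half of the statement that a flip exchanges the two parts of a circuit; the other half
  is the same statement for \<open>-c\<close> with \<open>S\<close> and \<open>T\<close> interchanged. A \<open>d\<close>-simplex on \<open>V\<close> other than the
  negative part avoids some point of that part and is therefore a face of \<open>T\<close>.
\<close>
lemma flip_exchange_aux:
  assumes V: "V \<subseteq> P" and c: "circuit P d c" "pos c \<union> neg c = V"
    and pos: "\<And>x. x \<in> pos c \<Longrightarrow> convex hull (V - {x}) \<in> S"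
    and neg: "\<And>x. x \<in> neg c \<Longrightarrow> convex hull (V - {x}) \<in> T"
    and outer: "\<And>\<sigma>. \<sigma> \<in> S \<Longrightarrow> \<sigma> \<notin> T \<Longrightarrow> \<exists>x\<in>pos c. \<sigma> = convex hull (V - {x})"
    and T: "triangulates T Q P"
  shows "mid_faces P d S - mid_faces P d T = {neg c}"
proof -
  have cV: "card (V - {x}) = 2 * d + 1" if "x \<in> V" for x
    using circuit_card[OF c(1)] c(2) that finite_subset_P[OF V] by simp
  have posc: "V - {x} \<in> cells P S" if "x \<in> pos c" for x
    using pos[OF that] cV[of x] that V c(2) by (auto simp: cells_def dim)
  have negc: "V - {x} \<in> cells P T" if "x \<in> neg c" for x
    using neg[OF that] cV[of x] that V c(2) by (auto simp: cells_def dim)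
  have ne: "pos c \<noteq> {}" "neg c \<noteq> {}" using c(1) unfolding circuit_def by (metis add_is_0 card.empty one_neq_zero)+
  then obtain x y where xy: "x \<in> pos c" "y \<in> neg c" by auto
  have "neg c \<subseteq> V - {x}" "pos c \<subseteq> V - {y}" using xy c(2) by auto
  then have in_S: "neg c \<in> mid_faces P d S" and "pos c \<in> mid_faces P d T"
    using posc[OF xy(1)] negc[OF xy(2)] c(1) unfolding mid_faces_def circuit_def by blast+
  then have notin_T: "neg c \<notin> mid_faces P d T" using mid_faces_no_crossing[OF T c(1)] by blast
  have "A = neg c" if A: "A \<in> mid_faces P d S" "A \<notin> mid_faces P d T" for A
  proof (rule ccontr)
    assume neq: "A \<noteq> neg c"
    obtain C where C: "C \<in> cells P S" "A \<subseteq> C" and cA: "card A = d + 1" using A(1) unfolding mid_faces_def by blast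
    have "convex hull C \<notin> T"
    proof
      assume "convex hull C \<in> T"
      then have "C \<in> cells P T" using C(1) by (simp add: cells_def)
      then show False using A(2) C(2) cA unfolding mid_faces_def by blast
    qed
    then obtain x where x: "x \<in> pos c" "convex hull C = convex hull (V - {x})"
      using outer cells_D[OF C(1)] by blast
    then have "C = V - {x}" using hull_inj cell_independent C(1) posc by blast
    then have AV: "A \<subseteq> V" using C(2) by blast
    have "\<not> neg c \<subseteq> A"
      using neq card_subset_eq[of A "neg c"] cA c(1) finite_subset_P V AV by (auto simp: circuit_def)
    then obtain y where y: "y \<in> neg c" "y \<notin> A" by blast
    then have "A \<subseteq> V - {y}" using AV by blast
    then show False using negc[OF y(1)] A(2) cA unfolding mid_faces_def by blast
  qed
  then show ?thesis using in_S notin_T by blast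
qed

theorem flip_imp_exchange:
  assumes S: "triangulates S (convex hull P) P" and T: "triangulates T (convex hull P) P"
    and flip: "bistellar_flip S T"
  shows "\<exists>A B. mid_faces P d S - mid_faces P d T = {A} \<and> mid_faces P d T - mid_faces P d S = {B}"
proof -
  obtain V U where V: "V \<subseteq> {v. \<exists>\<sigma>\<in>S. v extreme_point_of \<sigma>}" "card V = DIM('a) + 2"
    and SV: "triangulates {\<sigma>\<in>S. \<sigma> \<subseteq> convex hull V} (convex hull V) V"
    and U: "triangulates U (convex hull V) V" "U \<noteq> {\<sigma>\<in>S. \<sigma> \<subseteq> convex hull V}"
    and Teq: "T = (S - {\<sigma>\<in>S. \<sigma> \<subseteq> convex hull V}) \<union> U"
    using flip unfolding bistellar_flip_def by blast
  define SX where "SX = {\<sigma>\<in>S. \<sigma> \<subseteq> convex hull V}"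
  have VP: "V \<subseteq> P" using V(1) S unfolding triangulates_def by blast
  interpret V: neighbourly V d by (rule neighbourly_subset[OF VP])
  obtain u where u: "affine_relation V u" "u \<noteq> (\<lambda>_. 0)"
    using V.relation_exists[of V] V(2) dim by auto
  obtain c0 where c0: "circuit V d c0" using V.contains_circuit[OF u] by blast
  have c0V: "pos c0 \<union> neg c0 = V"
    using card_subset_eq[OF V.finite_P V.circuit_supp[OF c0]] V.circuit_card[OF c0] V(2) dim by simp
  have ne: "cells V SX \<noteq> cells V U"
    using V.triangulates_eq_image[OF SV] V.triangulates_eq_image[OF U(1)] U(2) unfolding SX_def by metis
  have "\<exists>c. circuit V d c \<and> pos c \<union> neg c = V \<and> cells V SX = (\<lambda>x. V - {x}) ` pos c \<and> cells V U = (\<lambda>x. V - {x}) ` neg c"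
  proof (cases "cells V SX = (\<lambda>x. V - {x}) ` pos c0")
    case True
    then have "cells V U = (\<lambda>x. V - {x}) ` neg c0"
      using V.two_triangulations[OF U(1) c0 c0V] ne by auto
    with True show ?thesis using c0 c0V by (intro exI[of _ c0]) simp
  next
    case False
    then have "cells V SX = (\<lambda>x. V - {x}) ` neg c0"
      using V.two_triangulations[OF SV c0 c0V] unfolding SX_def by simp
    moreover from this have "cells V U = (\<lambda>x. V - {x}) ` pos c0"
      using V.two_triangulations[OF U(1) c0 c0V] ne by auto
    moreover have "neg c0 \<union> pos c0 = V" using c0V by blast
    ultimately show ?thesis using circuit_uminus[OF c0] by (intro exI[of _ "\<lambda>v. - c0 v"]) simp
  qed
  then obtain c where c: "circuit V d c" "pos c \<union> neg c = V"
    and cS: "cells V SX = (\<lambda>x. V - {x}) ` pos c" and cU: "cells V U = (\<lambda>x. V - {x}) ` neg c" by blast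
  have cP: "circuit P d c" using c(1) affine_relation_mono[OF finite_P VP] by (simp add: circuit_def)
  have imS: "SX = (\<lambda>x. convex hull (V - {x})) ` pos c"
    using V.triangulates_eq_image[OF SV, folded SX_def] unfolding cS by (simp add: image_image)
  have imU: "U = (\<lambda>x. convex hull (V - {x})) ` neg c"
    using V.triangulates_eq_image[OF U(1)] unfolding cU by (simp add: image_image)
  have Teq': "T = (S - SX) \<union> U" using Teq by (simp add: SX_def)
  have "SX \<subseteq> S" by (auto simp: SX_def)
  define c' where "c' = (\<lambda>v. - c v)"
  have c': "circuit P d c'" "pos c' = neg c" "neg c' = pos c" "pos c' \<union> neg c' = V"
    using circuit_uminus[OF cP] c(2) by (auto simp: c'_def)
  have "mid_faces P d S - mid_faces P d T = {neg c}"
    by (rule flip_exchange_aux[OF VP cP c(2) _ _ _ T]) (use imS imU Teq' \<open>SX \<subseteq> S\<close> in blast)+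
  moreover have "mid_faces P d T - mid_faces P d S = {neg c'}"
  proof (rule flip_exchange_aux[OF VP c'(1,4) _ _ _ S])
    show "convex hull (V - {x}) \<in> T" if "x \<in> pos c'" for x
      using that unfolding c'(2) Teq' imU by blast
    show "convex hull (V - {x}) \<in> S" if "x \<in> neg c'" for x
      using that \<open>SX \<subseteq> S\<close> unfolding c'(3) imS by blast
    show "\<exists>x\<in>pos c'. \<sigma> = convex hull (V - {x})" if "\<sigma> \<in> T" "\<sigma> \<notin> S" for \<sigma>
      using that unfolding c'(2) Teq' imU by blast
  qed
  ultimately show ?thesis by simp
qed

section \<open>Exchanged faces and facets\<close>

text \<open>
  A face that contains the positive part contains the crossing point, which is in the relative
  interior of the negative part. So it contains all \<open>2d + 2\<close> points of the circuit, which span the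
  whole space.
\<close>
lemma circuit_not_in_facet:
  assumes c: "circuit P d c" and F: "F facet_of convex hull P" and sub: "convex hull (pos c) \<subseteq> F"
  shows False
proof -
  obtain s q where s: "barycentric P (\<lambda>v. max 0 (c v) / s) q" "barycentric P (\<lambda>v. max 0 (- c v) / s) q"
    "pos (\<lambda>v. max 0 (c v) / s) = pos c" "pos (\<lambda>v. max 0 (- c v) / s) = neg c"
    by (rule circuit_center[OF c])
  have P: "pos c \<subseteq> P" "neg c \<subseteq> P" using circuit_supp[OF c] by auto
  have "q \<in> rel_interior (convex hull neg c)" by (rule barycentric_rel_interior[OF s(2,4) P(2)])
  moreover have "q \<in> F" using barycentric_imp_hull[OF finite_P s(1)] s(3) sub by blast
  ultimately have "convex hull neg c \<subseteq> F"
    using subset_of_face_of[OF facet_of_imp_face_of[OF F] hull_mono[OF P(2)]] by blast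
  then have "pos c \<union> neg c \<subseteq> F"
    using sub hull_subset[of "pos c" convex] hull_subset[of "neg c" convex]
    by (intro Un_least) (erule (1) order_trans)+
  moreover have "affine hull (pos c \<union> neg c) = UNIV"
    using affine_hull_full[OF circuit_supp[OF c]] circuit_card[OF c] by simp
  ultimately have "affine hull F = UNIV" using hull_mono[of "pos c \<union> neg c" F affine] by auto
  then have "aff_dim F = int DIM('a)" by (metis aff_dim_UNIV aff_dim_affine_hull)
  then show False using F aff_dim_le_DIM[of "convex hull P"] by (simp add: facet_of_def)
qed

lemma changed_mid_face_not_in_facet:
  assumes "triangulates T (convex hull P) P" "A \<in> mid_faces P d S" "A \<notin> mid_faces P d T"
    and "F facet_of convex hull P"
  shows "\<not> convex hull A \<subseteq> F"
  using mid_face_nonface_crossed[OF assms(1-3)] circuit_not_in_facet assms(4) by blast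

text \<open>
  The faces of a simplex are the hulls of subsets of its vertices, and an affinely independent set
  can be recovered from its hull.
\<close>
lemma mid_face_iff_face_of:
  assumes S: "triangulates S Q P" and A: "A \<subseteq> P" "card A = d + 1"
  shows "A \<in> mid_faces P d S \<longleftrightarrow> (\<exists>\<sigma>\<in>S. convex hull A face_of \<sigma>)"
proof
  assume "A \<in> mid_faces P d S"
  then obtain C where "C \<in> cells P S" "A \<subseteq> C" unfolding mid_faces_def by blast
  then show "\<exists>\<sigma>\<in>S. convex hull A face_of \<sigma>"
    using face_of_convex_hull_affine_independent[OF cell_independent] cells_D by blast
next
  assume "\<exists>\<sigma>\<in>S. convex hull A face_of \<sigma>"
  then obtain \<sigma> where s: "\<sigma> \<in> S" "convex hull A face_of \<sigma>" by blast
  then obtain C where C: "C \<in> cells P S" "\<sigma> = convex hull C" using triangulates_cell[OF S] by blast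
  then obtain k where k: "k \<subseteq> C" "convex hull A = convex hull k"
    using s face_of_convex_hull_affine_independent[OF cell_independent] by blast
  have "\<not> affine_dependent A" by (rule affine_independent) (use A d_pos in auto)
  then have "A = k" using k hull_inj cell_independent[OF C(1)] affine_dependent_subset by metis
  then show "A \<in> mid_faces P d S" using k C A unfolding mid_faces_def by blast
qed

end

section \<open>The moment curve\<close>

lemma coordinate_of_degree:
  assumes "1 \<le> k" "k \<le> CARD('n::{finite,linorder})"
  shows "\<exists>i::'n. card {j. j \<le> i} = k"
proof -
  let ?f = "\<lambda>i::'n. card {j. j \<le> i}"
  have less: "?f i < ?f i'" if "i < i'" for i i'
  proof (rule psubset_card_mono)
    have "{j. j \<le> i} \<subseteq> {j. j \<le> i'}" using that by auto
    moreover have "i' \<in> {j. j \<le> i'} - {j. j \<le> i}" using that by auto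
    ultimately show "{j. j \<le> i} \<subset> {j. j \<le> i'}" by blast
  qed simp
  have "inj ?f"
    by (rule linorder_injI) (use less in \<open>metis less_irrefl\<close>)
  then have "card (range ?f) = card {1..CARD('n)}" by (simp add: card_image)
  moreover have "range ?f \<subseteq> {1..CARD('n)}"
  proof
    fix k assume "k \<in> range ?f"
    then obtain i where i: "k = ?f i" by blast
    have "{j. j \<le> i} \<noteq> {}" by blast
    then have "0 < ?f i" by (simp add: card_gt_0_iff)
    moreover have "?f i \<le> CARD('n)" by (intro card_mono) auto
    ultimately show "k \<in> {1..CARD('n)}" using i by simp
  qed
  ultimately have "range ?f = {1..CARD('n)}" by (intro card_subset_eq) auto
  then have "k \<in> range ?f" using assms by simp
  then show ?thesis by auto
qed

text \<open>
  The coordinates of the moment curve are the powers of the parameter up to the dimension, and the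
  sum of the coefficients accounts for the constants.
\<close>
lemma relation_annihilates_polynomials:
  fixes u :: "real ^ 'n::{finite,linorder} \<Rightarrow> real"
  assumes u: "affine_relation (moment_pt ` I) u" and q: "degree q \<le> CARD('n)"
  shows "(\<Sum>i\<in>I. u (moment_pt i) * poly q (real i)) = 0"
proof -
  let ?p = "moment_pt :: nat \<Rightarrow> (real, 'n) vec"
  have inj: "inj_on ?p I" using inj_moment_pt inj_on_subset by blast
  have s0: "(\<Sum>i\<in>I. u (?p i)) = 0"
    using u by (simp add: affine_relation_def sum.reindex[OF inj])
  have s1: "(\<Sum>i\<in>I. u (?p i) *\<^sub>R ?p i) = 0"
    using u by (simp add: affine_relation_def sum.reindex[OF inj])
  have power: "(\<Sum>i\<in>I. u (?p i) * real i ^ k) = 0" if k: "k \<le> CARD('n)" for k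
  proof (cases "k = 0")
    case False
    then obtain l :: 'n where l: "card {j. j \<le> l} = k" using coordinate_of_degree[of k, where ?'n = 'n] k by auto
    have "(\<Sum>i\<in>I. u (?p i) *\<^sub>R ?p i) $ l = (\<Sum>i\<in>I. u (?p i) * real i ^ k)"
      by (simp add: moment_pt_def l)
    then show ?thesis using s1 by simp
  qed (use s0 in simp)
  have "(\<Sum>i\<in>I. u (?p i) * poly q (real i))
      = (\<Sum>i\<in>I. \<Sum>k\<le>degree q. coeff q k * (u (?p i) * real i ^ k))"
    by (intro sum.cong refl) (simp add: poly_altdef sum_distrib_left algebra_simps)
  also have "\<dots> = (\<Sum>k\<le>degree q. coeff q k * (\<Sum>i\<in>I. u (?p i) * real i ^ k))"
    by (subst sum.swap) (simp add: sum_distrib_left)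
  also have "\<dots> = 0" using power q by (intro sum.neutral) auto
  finally show ?thesis .
qed

lemma moment_curve_neighbourly:
  assumes "CARD('n::{finite,linorder}) = 2 * d" "1 \<le> d"
  shows "neighbourly (moment_pt ` {1..m} :: (real, 'n) vec set) d"
proof
  let ?p = "moment_pt :: nat \<Rightarrow> (real, 'n) vec" and ?I = "{1..m}"
  show "finite (?p ` ?I)" by simp
  show "DIM((real, 'n) vec) = 2 * d" using assms(1) by simp
  show "1 \<le> d" by (rule assms(2))
  fix u :: "(real, 'n) vec \<Rightarrow> real"
  assume u: "affine_relation (?p ` ?I) u" "u \<noteq> (\<lambda>_. 0)"
  show "d + 1 \<le> card (pos u)"
  proof (rule ccontr)
    assume small: "\<not> d + 1 \<le> card (pos u)"
    define J where "J = {i\<in>?I. 0 < u (?p i)}"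
    have fJ: "finite J" by (simp add: J_def)
    have "pos u = ?p ` J" using u(1) by (force simp: J_def affine_relation_def)
    moreover have "card (?p ` J) = card J"
      by (rule card_image[OF inj_on_subset[OF inj_moment_pt]]) simp
    ultimately have cJ: "card J \<le> d" using small by simp
    \<comment> \<open>\<open>q\<close> vanishes where \<open>u\<close> is positive and is positive elsewhere.\<close>
    define q where "q = (\<Prod>j\<in>J. [:- real j, 1:] ^ 2)"
    have "degree q \<le> (\<Sum>j\<in>J. degree ([:- real j, 1:] ^ 2))"
      unfolding q_def by (rule degree_prod_sum_le[OF fJ, unfolded comp_def])
    also have "\<dots> = 2 * card J" by (simp add: degree_power_eq)
    finally have deg: "degree q \<le> CARD('n)" using cJ assms(1) by simp
    have q: "poly q (real i) = (\<Prod>j\<in>J. (real i - real j)\<^sup>2)" for i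
      by (simp add: q_def poly_prod)
    have q0: "poly q (real i) = 0" if "i \<in> J" for i
      unfolding q using that fJ by (intro prod_zero) auto
    have qp: "0 < poly q (real i)" if "i \<notin> J" for i
      unfolding q using that by (intro prod_pos) auto
    have le: "u (?p i) * poly q (real i) \<le> 0" if "i \<in> ?I" for i
      using that q0[of i] qp[of i] by (cases "i \<in> J") (auto simp: J_def mult_le_0_iff)
    have "\<forall>i\<in>?I. u (?p i) * poly q (real i) = 0"
      using relation_annihilates_polynomials[OF u(1) deg] le
        sum_nonneg_eq_0_iff[of ?I "\<lambda>i. - (u (?p i) * poly q (real i))"]
      by (simp add: sum_negf)
    then have "u (?p i) = 0" if "i \<in> ?I" "i \<notin> J" for i
      using qp[of i] that by (metis less_irrefl mult_eq_0_iff)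
    then have nn: "\<forall>v\<in>?p ` ?I. 0 \<le> u v" by (force simp: J_def)
    moreover have "sum u (?p ` ?I) = 0" using u(1) by (simp add: affine_relation_def)
    ultimately have "\<forall>v\<in>?p ` ?I. u v = 0"
      using sum_nonneg_eq_0_iff[of "?p ` ?I" u] by blast
    then have "u = (\<lambda>_. 0)" using u(1) unfolding affine_relation_def by blast
    then show False using u(2) by simp
  qed
qed

text \<open>
  An exchanged \<open>d\<close>-face is crossed by another one and so lies in no facet at all. Hence the condition
  on lower facets removes nothing from the difference.
\<close>
lemma card_e_set_diff:
  fixes S T :: "(real ^ 'n::{finite,linorder}) set set"
  assumes d: "1 \<le> d" "CARD('n) = 2 * d"
    and S: "triangulates S (cyclic_polytope m) (moment_pt ` {1..m})"
    and T: "triangulates T (cyclic_polytope m) (moment_pt ` {1..m})"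
  shows "card (e_set d m S - e_set d m T) =
    card (mid_faces (moment_pt ` {1..m}) d S - mid_faces (moment_pt ` {1..m}) d T)"
proof -
  let ?p = "moment_pt :: nat \<Rightarrow> (real, 'n) vec"
  let ?P = "?p ` {1..m}"
  interpret neighbourly ?P d by (rule moment_curve_neighbourly[OF d(2,1)])
  define low where "low A \<longleftrightarrow> (\<exists>F. lower_facet_of F (cyclic_polytope m :: (real, 'n) vec set) \<and> convex hull A \<subseteq> F)"
    for A :: "(real, 'n) vec set"
  have inj: "inj ?p" by (rule inj_moment_pt)
  have e: "L \<in> e_set d m R \<longleftrightarrow> length L = d + 1 \<and> sorted_wrt (<) L \<and> set L \<subseteq> {1..m} \<and>
      ?p ` set L \<in> mid_faces ?P d R \<and> \<not> low (?p ` set L)"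
    if R: "triangulates R (cyclic_polytope m) ?P" for L R
  proof (cases "length L = d + 1 \<and> sorted_wrt (<) L \<and> set L \<subseteq> {1..m}")
    case True
    then have "card (?p ` set L) = d + 1"
      using card_image[OF inj_on_subset[OF inj]] distinct_card[of L] strict_sorted_iff by auto
    moreover have "?p ` set L \<subseteq> ?P" using True by blast
    ultimately show ?thesis
      using mid_face_iff_face_of[OF R] True by (simp add: e_set_def low_def)
  qed (auto simp: e_set_def)
  have "inj_on (\<lambda>L. ?p ` set L) (e_set d m S - e_set d m T)"
  proof (rule inj_onI)
    fix L L' assume L: "L \<in> e_set d m S - e_set d m T" "L' \<in> e_set d m S - e_set d m T"
      and "?p ` set L = ?p ` set L'"
    then have "set L = set L'" using inj by (simp add: inj_image_eq_iff)
    then show "L = L'" using L strict_sorted_equal by (metis DiffD1 e[OF S])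
  qed
  moreover have "(\<lambda>L. ?p ` set L) ` (e_set d m S - e_set d m T) = mid_faces ?P d S - mid_faces ?P d T"
  proof (intro equalityI subsetI)
    fix A assume "A \<in> (\<lambda>L. ?p ` set L) ` (e_set d m S - e_set d m T)"
    then show "A \<in> mid_faces ?P d S - mid_faces ?P d T" using e[OF S] e[OF T] by auto
  next
    fix A assume A: "A \<in> mid_faces ?P d S - mid_faces ?P d T"
    then have A1: "A \<in> mid_faces ?P d S" "A \<notin> mid_faces ?P d T" by auto
    have AP: "A \<subseteq> ?P" "card A = d + 1" using mid_face_subset[OF A1(1)] by auto
    then obtain I where I: "I \<subseteq> {1..m}" "A = ?p ` I" by (meson subset_imageE)
    have fI: "finite I" using I(1) finite_subset by blast
    have cI: "card I = d + 1" using AP(2) I(2) card_image[OF inj_on_subset[OF inj], of I] by simp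
    define L where "L = sorted_list_of_set I"
    have L: "length L = d + 1" "sorted_wrt (<) L" "set L = I" using fI cI by (auto simp: L_def)
    have "\<not> low A" using changed_mid_face_not_in_facet[OF _ A1] T
      unfolding low_def lower_facet_of_def cyclic_polytope_def by blast
    then have "L \<in> e_set d m S - e_set d m T" using e[OF S] e[OF T] L I A1 by simp
    then show "A \<in> (\<lambda>L. ?p ` set L) ` (e_set d m S - e_set d m T)" using L(3) I(2) by blast
  qed
  ultimately show ?thesis by (metis card_image)
qed

theorem theorem4p1:
  fixes d m :: nat
    and S T :: "(real ^ 'n::{finite,linorder}) set set"
  assumes "d \<ge> 1"
    and "CARD('n) = 2 * d"
    and "m \<ge> 2 * d + 1"
    and "cyclic_triangulation m S"
    and "cyclic_triangulation m T"
  shows "bistellar_flip S T \<longleftrightarrow>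
         card (e_set d m S - e_set d m T) = 1 \<and> card (e_set d m T - e_set d m S) = 1"
proof -
  let ?P = "moment_pt ` {1..m} :: (real, 'n) vec set"
  interpret neighbourly ?P d by (rule moment_curve_neighbourly[OF assms(2,1)])
  have "2 \<le> CARD('n)" using assms(1,2) by simp
  then have S: "triangulates S (cyclic_polytope m) ?P" and T: "triangulates T (cyclic_polytope m) ?P"
    using assms(4,5) unfolding cyclic_triangulation_def by (simp_all add: vertices_cyclic_polytope)
  have S': "triangulates S (convex hull ?P) ?P" and T': "triangulates T (convex hull ?P) ?P"
    using S T by (simp_all add: cyclic_polytope_def)
  have "bistellar_flip S T \<longleftrightarrow> (\<exists>A B. mid_faces ?P d S - mid_faces ?P d T = {A} \<and>
      mid_faces ?P d T - mid_faces ?P d S = {B})"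
  proof
    assume "\<exists>A B. mid_faces ?P d S - mid_faces ?P d T = {A} \<and>
      mid_faces ?P d T - mid_faces ?P d S = {B}"
    then obtain A B where "mid_faces ?P d S - mid_faces ?P d T = {A}"
      "mid_faces ?P d T - mid_faces ?P d S = {B}" by blast
    then show "bistellar_flip S T" by (rule exchange_imp_flip[OF S' T'])
  qed (rule flip_imp_exchange[OF S' T'])
  then show ?thesis
    unfolding card_e_set_diff[OF assms(1,2) S T] card_e_set_diff[OF assms(1,2) T S]
    by (simp add: card_1_singleton_iff)
qed

end
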